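(* Let $x$ and $y$ be normal infinite words over a finite alphabet $A$. If $x$ and $y$ are finite-state independent, then their join $x\vee y$ is normal.
   Context: For $x=a_1a_2\cdots$ and $y=b_1b_2\cdots$ the join is $x\vee y=a_1b_1a_2b_2\cdots$. For words $w,u$, the number of aligned occurrences $|w|_u^{al}$ is $|\{i: w[i..i+|u|-1]=u,\ i\equiv 1 \bmod |u|\}|$ (positions start at 1). An infinite word $x$ is normal if for every $\ell\ge1$ and every $u\in A^\ell$, $\lim_{n\to\infty}|x[1..n]|^{al}_u/(n/\ell)=|A|^{-\ell}$. A $k$-automaton is a tuple $\langle Q,A,\delta,I\rangle$ with finite state set $Q$, transition relation $\delta\subseteq Q\times(A\cup\{\varepsilon\})^k\times Q$ and set $I$ of initial states; an infinite run is accepting if it starts in an initial state and all $k$ components of its label (componentwise concatenation of transition labels) are infinite. It is $\ell$-deterministic if $I$ is a singleton and for any two transitions leaving the same state $p$ with labels $(\alpha_1,\dots,\alpha_k)$, $(\alpha'_1,\dots,\alpha'_k)$: $\alpha_j=\varepsilon$ for some $j\le\ell$ implies $\alpha'_j=\varepsilon$, and $\alpha_i=\alpha'_i$ for all $i\le\ell$ implies equality of the remaining label components and of target states; it then realizes a partial function from the first $\ell$ tapes to the last $k-\ell$. For a $1$-deterministic $2$-automaton $\mathcal T$ and $x=a_1a_2\cdots$ with accepting run $q_0\xrightarrow{a_1|v_1}q_1\xrightarrow{a_2|v_2}\cdots$, $\rho_{\mathcal T}(x)=\liminf_n|v_1\cdots v_n|/n$; $\rho(x)$ is the infimum over one-to-one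 (injective) such $\mathcal T$. A compressor is a $2$-deterministic $3$-automaton $\mathcal C$ with input tapes $x$ and oracle $y$ such that $x\mapsto\mathcal C(x,y)$ is injective for each fixed $y$; with accepting run $q_0\xrightarrow{\alpha_1,\beta_1|w_1}q_1\cdots$, $\rho_{\mathcal C}(x/y)=\liminf_n|w_1\cdots w_n|/|\alpha_1\cdots\alpha_n|$, and $\rho(x/y)$ is the infimum over compressors. $x,y$ are finite-state independent if $\rho(x/y)=\rho(x)$, $\rho(y/x)=\rho(y)$ and $\rho(x),\rho(y)$ are nonzero. *)

theory Defs
  imports Complex_Main "HOL-Library.Infinite_Set" "HOL-Library.Extended_Real" "HOL-Library.Liminf_Limsup"
begin

(* Infinite words over the finite alphabet A = UNIV :: 'a set are functions nat => 'a,
   positions are 0-based here (position i here = position i+1 in the paper). *)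

definition join :: "(nat \<Rightarrow> 'a) \<Rightarrow> (nat \<Rightarrow> 'a) \<Rightarrow> nat \<Rightarrow> 'a" where
  "join x y n = (if even n then x (n div 2) else y (n div 2))"

definition aligned_count :: "(nat \<Rightarrow> 'a) \<Rightarrow> nat \<Rightarrow> 'a list \<Rightarrow> nat" where
  "aligned_count x n u = card {i. i + length u \<le> n \<and> i mod length u = 0 \<and>
                                  (\<forall>j<length u. x (i + j) = u ! j)}"

definition normal :: "(nat \<Rightarrow> 'a::finite) \<Rightarrow> bool" where
  "normal x \<longleftrightarrow> (\<forall>l::nat. l \<ge> 1 \<longrightarrow> (\<forall>u::'a list. length u = l \<longrightarrow>
      (\<lambda>n. real (aligned_count x n u) / (real n / real l))
        \<longlonglongrightarrow> 1 / real (card (UNIV :: 'a set)) ^ l))"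

(* k-automata: states are natural numbers; an automaton is (Q, delta, I);
   a label in (A \<union> {eps})^k is a list of length k of 'a option (None = eps). *)
type_synonym 'a aut = "nat set \<times> (nat \<times> 'a option list \<times> nat) set \<times> nat set"

definition is_aut :: "nat \<Rightarrow> 'a aut \<Rightarrow> bool" where
  "is_aut k M = (case M of (Q, \<delta>, I) \<Rightarrow> finite Q \<and> I \<subseteq> Q \<and>
      (\<forall>(p, \<alpha>, q) \<in> \<delta>. p \<in> Q \<and> q \<in> Q \<and> length \<alpha> = k))"

definition is_run :: "'a aut \<Rightarrow> (nat \<Rightarrow> nat) \<Rightarrow> (nat \<Rightarrow> 'a option list) \<Rightarrow> bool" where
  "is_run M s l = (case M of (Q, \<delta>, I) \<Rightarrow> s 0 \<in> I \<and> (\<forall>i. (s i, l i, s (Suc i)) \<in> \<delta>))"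

definition comp_pos :: "(nat \<Rightarrow> 'a option list) \<Rightarrow> nat \<Rightarrow> nat set" where
  "comp_pos l j = {i. l i ! j \<noteq> None}"

definition accepting :: "nat \<Rightarrow> 'a aut \<Rightarrow> (nat \<Rightarrow> nat) \<Rightarrow> (nat \<Rightarrow> 'a option list) \<Rightarrow> bool" where
  "accepting k M s l \<longleftrightarrow> is_run M s l \<and> (\<forall>j<k. infinite (comp_pos l j))"

(* the j-th component of the label of a run, as an infinite word
   (meaningful when that component is infinite) *)
definition comp_word :: "(nat \<Rightarrow> 'a option list) \<Rightarrow> nat \<Rightarrow> nat \<Rightarrow> 'a" where
  "comp_word l j m = the (l (enumerate (comp_pos l j) m) ! j)"

(* l-deterministic k-automaton (tapes numbered 0..k-1; the first l tapes are inputs) *)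
definition ldet :: "nat \<Rightarrow> nat \<Rightarrow> 'a aut \<Rightarrow> bool" where
  "ldet l k M = (is_aut k M \<and> (case M of (Q, \<delta>, I) \<Rightarrow> (\<exists>q0. I = {q0}) \<and>
      (\<forall>p \<alpha> q \<alpha>' q'. (p, \<alpha>, q) \<in> \<delta> \<longrightarrow> (p, \<alpha>', q') \<in> \<delta> \<longrightarrow>
         (\<forall>j<l. \<alpha> ! j = None \<longrightarrow> \<alpha>' ! j = None) \<and>
         ((\<forall>i<l. \<alpha> ! i = \<alpha>' ! i) \<longrightarrow> (\<forall>i. l \<le> i \<and> i < k \<longrightarrow> \<alpha> ! i = \<alpha>' ! i) \<and> q = q'))))"

definition injective_transducer :: "'a aut \<Rightarrow> bool" where
  "injective_transducer T \<longleftrightarrow> ldet 1 2 T \<and>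
     (\<forall>s l s' l'. accepting 2 T s l \<longrightarrow> accepting 2 T s' l' \<longrightarrow>
        comp_word l 1 = comp_word l' 1 \<longrightarrow> comp_word l 0 = comp_word l' 0)"

definition ncount :: "(nat \<Rightarrow> 'a option list) \<Rightarrow> nat \<Rightarrow> nat \<Rightarrow> nat" where
  "ncount l j t = card {i. i < t \<and> l i ! j \<noteq> None}"

(* rho_T(x) for the accepting run (s,l): grouping the run as q0 -a1|v1-> q1 -a2|v2-> ...,
   |v_1...v_n| is the number of output letters produced up to and including the
   transition reading the n-th input letter; the sequence below is indexed by n-1. *)
definition rho_T_run :: "(nat \<Rightarrow> 'a option list) \<Rightarrow> ereal" where
  "rho_T_run l = liminf (\<lambda>n. ereal (real (ncount l 1 (enumerate (comp_pos l 0) n + 1)) / real (Suc n)))"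

definition rho :: "(nat \<Rightarrow> 'a) \<Rightarrow> ereal" where
  "rho x = Inf {rho_T_run l | T s l. injective_transducer T \<and> accepting 2 T s l \<and> comp_word l 0 = x}"

(* compressors: 2-deterministic 3-automata, tapes 0 = input x, 1 = oracle y, 2 = output,
   such that x |-> C(x,y) is injective for each fixed y *)
definition compressor :: "'a aut \<Rightarrow> bool" where
  "compressor C \<longleftrightarrow> ldet 2 3 C \<and>
     (\<forall>s l s' l'. accepting 3 C s l \<longrightarrow> accepting 3 C s' l' \<longrightarrow>
        comp_word l 1 = comp_word l' 1 \<longrightarrow> comp_word l 2 = comp_word l' 2 \<longrightarrow>
        comp_word l 0 = comp_word l' 0)"

definition rho_C_run :: "(nat \<Rightarrow> 'a option list) \<Rightarrow> ereal" where
  "rho_C_run l = liminf (\<lambda>n. ereal (real (ncount l 2 n) / real (ncount l 0 n)))"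

definition rho_cond :: "(nat \<Rightarrow> 'a) \<Rightarrow> (nat \<Rightarrow> 'a) \<Rightarrow> ereal" where
  "rho_cond x y = Inf {rho_C_run l | C s l. compressor C \<and> accepting 3 C s l \<and>
                         comp_word l 0 = x \<and> comp_word l 1 = y}"

definition fs_independent :: "(nat \<Rightarrow> 'a) \<Rightarrow> (nat \<Rightarrow> 'a) \<Rightarrow> bool" where
  "fs_independent x y \<longleftrightarrow> rho_cond x y = rho x \<and> rho_cond y x = rho y \<and>
                           rho x \<noteq> 0 \<and> rho y \<noteq> 0"

end

theory Submission
  imports Defs "HOL-Library.Cardinality" "HOL-Library.Countable" "HOL-Library.Sublist"
begin

text \<open>Both halves are counting arguments on aligned blocks. A normal word is incompressible: an injective
  transducer maps few blocks to short outputs, and a normal word meets these rarely, so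
  \<open>\<rho>(x) \<ge> 1\<close> (unless the alphabet is a singleton, when the theorem is trivial). On the other hand,
  if the join is not normal, then some pair \<open>(u, v)\<close> of words of equal length occurs at the same
  aligned position of \<open>x\<close> and \<open>y\<close> with too large a frequency infinitely often. As \<open>v\<close> has the
  right frequency in \<open>y\<close>, guessing \<open>u\<close> slightly more often than uniformly when \<open>v\<close> is seen on the
  oracle tape saves a positive proportion of the letters, and \<open>\<rho>(x/y) < 1\<close>. Since \<open>\<rho>\<close> is a lower
  limit, a saving infinitely often is enough.\<close>

section \<open>Labels of runs and aligned blocks\<close>

text \<open>Write N for the number of words of length l. A block of odd length in the join takes
  unequal numbers of letters from x and y. Blocks of length 2l avoid this: the i-th one interleaves
  the i-th blocks of length l of x and y. So it is enough to bound the frequency of each pair of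
  words of length l by 1/N^2 + eta, and to return from 2l to l by cutting blocks in half.

  A code for single pairs need not compress: the mean saving per block may be far below one letter,
  while code words have integral length. Hence k blocks share one code word, with k so large that
  the rounding loss is a fraction of the saving. Losses also occur on the blocks where v faces a
  word other than u; the normality of y controls their number.

  A transition writes at most one letter, so the compressor keeps a finished code word in its state
  and writes it while both input tapes stand still. Transducers may make such silent moves as well,
  so input blocks are compared through the run segments that read them, and these segments may
  differ in length.\<close>

definition words :: "nat \<Rightarrow> 'a list set" where
  "words n = {w. length w = n}"

lemma words_iff [simp]: "w \<in> words n \<longleftrightarrow> length w = n"
  by (simp add: words_def)

lemma finite_words [simp]: "finite (words n :: 'a::finite list set)"
  using finite_lists_length_eq[of "UNIV :: 'a set" n] by (simp add: words_def)

lemma card_words: "card (words n :: 'a::finite list set) = CARD('a) ^ n"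
  using card_lists_length_eq[of "UNIV :: 'a set" n] by (simp add: words_def)

definition seg :: "(nat \<Rightarrow> 'a option list) \<Rightarrow> nat \<Rightarrow> nat \<Rightarrow> nat \<Rightarrow> 'a list" where
  "seg l j a b = List.map_filter (\<lambda>i. l i ! j) [a..<b]"

lemma map_filter_append:
  "List.map_filter f (xs @ ys) = List.map_filter f xs @ List.map_filter f ys"
  by (simp add: List.map_filter_def)

lemma seg_refl [simp]: "seg l j a a = []"
  by (simp add: seg_def List.map_filter_def)

lemma seg_append: "a \<le> b \<Longrightarrow> b \<le> c \<Longrightarrow> seg l j a c = seg l j a b @ seg l j b c"
  unfolding seg_def by (metis le_Suc_ex map_filter_append upt_add_eq_append)

lemma seg_Suc:
  "a \<le> b \<Longrightarrow> seg l j a (Suc b) = seg l j a b @ (case l b ! j of None \<Rightarrow> [] | Some c \<Rightarrow> [c])"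
  by (simp add: seg_def map_filter_append split: option.split)

lemma seg_shift:
  assumes "\<And>i. i < n \<Longrightarrow> l (a + i) ! j = l' (b + i) ! j"
  shows "seg l j a (a + n) = seg l' j b (b + n)"
  using assms by (induction n) (auto simp: seg_Suc)

lemma length_seg: "length (seg l j a b) = card {i \<in> {a..<b}. l i ! j \<noteq> None}"
proof -
  have "length (seg l j a b) = length (filter (\<lambda>i. l i ! j \<noteq> None) [a..<b])"
    by (simp add: seg_def List.map_filter_def)
  also have "\<dots> = card (set (filter (\<lambda>i. l i ! j \<noteq> None) [a..<b]))"
    by (rule distinct_card[symmetric]) simp
  also have "set (filter (\<lambda>i. l i ! j \<noteq> None) [a..<b]) = {i \<in> {a..<b}. l i ! j \<noteq> None}"
    by auto
  finally show ?thesis .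
qed

lemma ncount_eq_length_seg: "ncount l j n = length (seg l j 0 n)"
  by (simp add: length_seg ncount_def)

lemma card_less_enumerate:
  assumes "infinite (S :: nat set)"
  shows "card {i. i < enumerate S m \<and> i \<in> S} = m"
proof -
  have "{i. i < enumerate S m \<and> i \<in> S} = enumerate S ` {..<m}"
  proof (intro equalityI subsetI)
    fix i assume "i \<in> {i. i < enumerate S m \<and> i \<in> S}"
    then have "i \<in> S" "i < enumerate S m" by auto
    moreover from \<open>i \<in> S\<close> obtain k where "enumerate S k = i"
      using enumerate_Ex[OF assms] by metis
    ultimately show "i \<in> enumerate S ` {..<m}"
      using enumerate_mono_iff[OF assms] by blast
  next
    fix i assume "i \<in> enumerate S ` {..<m}"
    then show "i \<in> {i. i < enumerate S m \<and> i \<in> S}"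
      using enumerate_mono_iff[OF assms] enumerate_in_set[OF assms] by blast
  qed
  then show ?thesis
    by (simp add: card_image inj_on_subset[OF inj_enumerate[OF assms]])
qed

lemma ncount_enumerate:
  assumes "infinite (comp_pos l j)"
  shows "ncount l j (enumerate (comp_pos l j) m) = m"
  using card_less_enumerate[OF assms, of m] by (simp add: ncount_def comp_pos_def)

lemma ncount_mono: "a \<le> b \<Longrightarrow> ncount l j a \<le> ncount l j b"
  unfolding ncount_eq_length_seg by (simp add: seg_append[of 0 a b])

lemma comp_word_ncount:
  assumes inf: "infinite (comp_pos l j)" and "l i ! j = Some a"
  shows "comp_word l j (ncount l j i) = a"
proof -
  have "i \<in> comp_pos l j" using assms by (simp add: comp_pos_def)
  then obtain m where m: "enumerate (comp_pos l j) m = i"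
    using enumerate_Ex[OF inf] by metis
  then have "ncount l j i = m" using ncount_enumerate[OF inf, of m] by simp
  with m show ?thesis using assms by (simp add: comp_word_def)
qed

lemma seg_eq_map_word:
  assumes "\<And>i a. l i ! j = Some a \<Longrightarrow> a = x (ncount l j i)"
  shows "seg l j 0 n = map x [0..<ncount l j n]"
proof (induction n)
  case 0
  show ?case by (simp add: ncount_def)
next
  case (Suc n)
  show ?case
  proof (cases "l n ! j")
    case None
    then have "ncount l j (Suc n) = ncount l j n"
      by (simp add: seg_Suc ncount_eq_length_seg)
    with None show ?thesis using Suc by (simp add: seg_Suc)
  next
    case (Some a)
    with assms have "a = x (ncount l j n)" by blast
    moreover have "ncount l j (Suc n) = Suc (ncount l j n)"
      using Some by (simp add: seg_Suc ncount_eq_length_seg)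
    ultimately show ?thesis using Suc Some by (simp add: seg_Suc)
  qed
qed

lemma seg_eq_map_comp_word:
  "infinite (comp_pos l j) \<Longrightarrow> seg l j 0 n = map (comp_word l j) [0..<ncount l j n]"
  by (rule seg_eq_map_word) (simp add: comp_word_ncount)

text \<open>Acceptance is verified in this form for spliced and for constructed runs, whose letter
  counts are known only at suitable times.\<close>

lemma infinite_comp_pos_iff: "infinite (comp_pos l j) \<longleftrightarrow> (\<forall>m. \<exists>n. m \<le> ncount l j n)"
proof
  assume "infinite (comp_pos l j)"
  then show "\<forall>m. \<exists>n. m \<le> ncount l j n" using ncount_enumerate by (metis order_refl)
next
  assume R: "\<forall>m. \<exists>n. m \<le> ncount l j n"
  show "infinite (comp_pos l j)"
  proof
    assume fin: "finite (comp_pos l j)"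
    obtain n where "Suc (card (comp_pos l j)) \<le> ncount l j n" using R by blast
    moreover have "ncount l j n \<le> card (comp_pos l j)"
      unfolding ncount_def by (rule card_mono[OF fin]) (auto simp: comp_pos_def)
    ultimately show False by simp
  qed
qed

text \<open>Identifies the tapes of a run built by hand: correctness of the letters is checked
  transition by transition, and infinity of the tape is supplied separately.\<close>

lemma comp_word_eqI:
  assumes "\<And>i a. l i ! j = Some a \<Longrightarrow> a = x (ncount l j i)" and "infinite (comp_pos l j)"
  shows "comp_word l j = x"
proof
  fix m
  let ?i = "enumerate (comp_pos l j) m"
  have "?i \<in> comp_pos l j" using assms(2) by (rule enumerate_in_set)
  then obtain a where a: "l ?i ! j = Some a" by (auto simp: comp_pos_def)
  with assms(1) have "a = x m" using ncount_enumerate[OF assms(2), of m] by metis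
  with a show "comp_word l j m = x m" by (simp add: comp_word_def)
qed

lemma comp_word_eq_nth_seg:
  "infinite (comp_pos l j) \<Longrightarrow> m < ncount l j n \<Longrightarrow> comp_word l j m = seg l j 0 n ! m"
  by (simp add: seg_eq_map_comp_word)

section \<open>Aligned blocks of an infinite word and their frequencies\<close>

definition block :: "nat \<Rightarrow> (nat \<Rightarrow> 'a) \<Rightarrow> nat \<Rightarrow> 'a list" where
  "block L x i = map x [i * L..<Suc i * L]"

lemma length_block [simp]: "length (block L x i) = L"
  by (simp add: block_def)

lemma nth_block: "j < L \<Longrightarrow> block L x i ! j = x (i * L + j)"
  by (simp add: block_def)

definition block_count :: "nat \<Rightarrow> (nat \<Rightarrow> 'a) \<Rightarrow> 'a list \<Rightarrow> nat \<Rightarrow> nat" where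
  "block_count L x u m = card {i. i < m \<and> block L x i = u}"

lemma aligned_count_eq_block_count:
  assumes "L > 0" "length u = L"
  shows "aligned_count x n u = block_count L x u (n div L)"
proof -
  have *: "block L x i = u \<longleftrightarrow> (\<forall>j<L. x (i * L + j) = u ! j)" for i
    using assms by (simp add: list_eq_iff_nth_eq nth_block)
  have "{i. i + L \<le> n \<and> i mod L = 0 \<and> (\<forall>j<L. x (i + j) = u ! j)} =
      (\<lambda>i. i * L) ` {i. i < n div L \<and> block L x i = u}" (is "?A = ?f ` ?B")
  proof (intro equalityI subsetI)
    fix i assume i: "i \<in> ?A"
    then have "i = i div L * L" using div_mult_mod_eq[of i L] by simp
    then obtain k where k: "i = k * L" ..
    with i have "Suc k * L \<le> n" by simp
    then have "Suc k \<le> n div L" using assms(1) by (simp only: less_eq_div_iff_mult_less_eq)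
    then show "i \<in> ?f ` ?B" using i k * by auto
  next
    fix i assume "i \<in> ?f ` ?B"
    then obtain k where k: "i = k * L" "k < n div L" "block L x k = u" by auto
    then have "Suc k \<le> n div L" by simp
    then have "Suc k * L \<le> n" using assms(1) by (simp only: less_eq_div_iff_mult_less_eq)
    then show "i \<in> ?A" using k * by simp
  qed
  moreover have "inj_on ?f ?B" using assms(1) by (auto simp: inj_on_def)
  ultimately show ?thesis
    using assms(2) by (simp add: aligned_count_def block_count_def card_image)
qed

lemma sum_block_count:
  assumes "finite B"
  shows "(\<Sum>u\<in>B. block_count L x u m) = card {i. i < m \<and> block L x i \<in> B}"
proof -
  have "{i. i < m \<and> block L x i \<in> B} = (\<Union>u\<in>B. {i. i < m \<and> block L x i = u})" by auto
  then show ?thesis unfolding block_count_def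
    by (simp only:) (subst card_UN_disjoint, use assms in auto)
qed

text \<open>The limit in \<open>normal\<close> is restricted to the prefix lengths
  \<open>m * L\<close>, where the quotient by \<open>L\<close> is the number of blocks
  itself.\<close>

lemma normal_block_count:
  fixes x :: "nat \<Rightarrow> 'a::finite"
  assumes "normal x" "L > 0" "length u = L"
  shows "(\<lambda>m. real (block_count L x u m) / real m) \<longlonglongrightarrow> 1 / real (CARD('a) ^ L)"
proof -
  have "(\<lambda>n. real (aligned_count x n u) / (real n / real L)) \<longlonglongrightarrow> 1 / real CARD('a) ^ L"
    using assms by (simp add: normal_def)
  then have "(\<lambda>m. real (aligned_count x (m * L) u) / (real (m * L) / real L))
      \<longlonglongrightarrow> 1 / real CARD('a) ^ L"
    by (rule filterlim_compose) (use assms mult_nat_right_at_top in auto)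
  then show ?thesis using assms by (simp add: aligned_count_eq_block_count)
qed

section \<open>Normal words are incompressible\<close>

text \<open>Cut and paste: the stretch from \<open>a\<close> to \<open>b\<close> is replaced by a
  copy of the \<open>d\<close> entries from \<open>c\<close> on. It serves states and labels alike,
  and \<open>d\<close> may differ from \<open>b - a\<close> because of silent moves.\<close>

definition swap_segment :: "nat \<Rightarrow> nat \<Rightarrow> nat \<Rightarrow> nat \<Rightarrow> (nat \<Rightarrow> 'b) \<Rightarrow> nat \<Rightarrow> 'b" where
  "swap_segment a b c d f n =
    (if n < a then f n else if n < a + d then f (c + (n - a)) else f (b + (n - (a + d))))"

lemma seg_swap_segment:
  "seg (swap_segment a b c d l) j 0 (a + d + r) =
    seg l j 0 a @ seg l j c (c + d) @ seg l j b (b + r)"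
proof -
  let ?l = "swap_segment a b c d l"
  have "seg ?l j 0 a = seg l j 0 a"
    using seg_shift[of a ?l 0 j l 0] by (simp add: swap_segment_def)
  moreover have "seg ?l j a (a + d) = seg l j c (c + d)"
    using seg_shift[of d ?l a j l c] by (simp add: swap_segment_def)
  moreover have "seg ?l j (a + d) (a + d + r) = seg l j b (b + r)"
    using seg_shift[of r ?l "a + d" j l b] by (simp add: swap_segment_def)
  ultimately show ?thesis
    using seg_append[of 0 a "a + d + r" ?l j]
      seg_append[of a "a + d" "a + d + r" ?l j] by simp
qed

lemma is_run_swap_segment:
  assumes run: "is_run M s l" and st: "s a = s c" "s b = s (c + d)"
  shows "is_run M (swap_segment a b c d s) (swap_segment a b c d l)"
proof -
  obtain Q \<delta> I where M: "M = (Q, \<delta>, I)" by (metis prod_cases3)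
  have s0: "s 0 \<in> I" and step: "(s i, l i, s (Suc i)) \<in> \<delta>" for i
    using run by (auto simp: is_run_def M)
  let ?s = "swap_segment a b c d s" and ?l = "swap_segment a b c d l"
  \<comment> \<open>For \<open>d = 0\<close> the pasted stretch is empty and position
    \<open>a\<close> already shows \<open>s b\<close>; the two hypotheses on states then give
    \<open>s b = s c = s a\<close>.\<close>
  have at_a: "?s a = s a" using st by (cases "d = 0") (auto simp: swap_segment_def)
  have at_d: "?s (a + d) = s b" by (simp add: swap_segment_def)
  have "?s 0 \<in> I"
  proof (cases "a = 0")
    case True
    then show ?thesis using at_a s0 by simp
  next
    case False
    then show ?thesis using s0 by (simp add: swap_segment_def)
  qed
  moreover have "(?s n, ?l n, ?s (Suc n)) \<in> \<delta>" for n
  proof -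
    consider "Suc n < a" | "Suc n = a" | "a \<le> n" "Suc n < a + d" | "a \<le> n" "Suc n = a + d"
      | "a + d \<le> n" by linarith
    then show ?thesis
    proof cases
      case 1
      then show ?thesis using step[of n] by (simp add: swap_segment_def)
    next
      case 2
      then have "?s n = s n" "?l n = l n" by (auto simp: swap_segment_def)
      then show ?thesis using step[of n] at_a 2 by simp
    next
      case 3
      then show ?thesis using step[of "c + (n - a)"] by (simp add: swap_segment_def Suc_diff_le)
    next
      case 4
      then have "?s n = s (c + (n - a))" "?l n = l (c + (n - a))" by (auto simp: swap_segment_def)
      moreover have "Suc (c + (n - a)) = c + d" using 4 by linarith
      ultimately show ?thesis using step[of "c + (n - a)"] 4 at_d st(2) by metis
    next
      case 5
      then show ?thesis using step[of "b + (n - (a + d))"] by (simp add: swap_segment_def Suc_diff_le)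
    qed
  qed
  ultimately show ?thesis by (simp add: is_run_def M)
qed

text \<open>Replacing one segment of the run by the other leaves the output unchanged, so injectivity
  forbids the input to change.\<close>

lemma injective_transducer_segment:
  assumes inj: "injective_transducer T" and acc: "accepting 2 T s l"
    and le: "a \<le> b" "a' \<le> b'" and st: "s a = s a'" "s b = s b'"
    and out: "seg l 1 a b = seg l 1 a' b'"
    and len: "length (seg l 0 a b) = length (seg l 0 a' b')"
  shows "seg l 0 a b = seg l 0 a' b'"
proof -
  define d where "d = b' - a'"
  define s' l' where "s' = swap_segment a b a' d s" and "l' = swap_segment a b a' d l"
  have d: "a' + d = b'" using le by (simp add: d_def)
  have seg': "seg l' j 0 (a + d + r) = seg l j 0 a @ seg l j a' b' @ seg l j b (b + r)" for j r
    unfolding l'_def using seg_swap_segment[of a b a' d l j r] by (simp add: d)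
  have seg: "seg l j 0 (b + r) = seg l j 0 a @ seg l j a b @ seg l j b (b + r)" for j r
    using seg_append[of 0 a "b + r" l j] seg_append[of a b "b + r" l j] le(1) by simp
  have inf: "infinite (comp_pos l j)" if "j < 2" for j
    using acc that by (simp add: accepting_def)
  \<comment> \<open>The exchanged segments carry equally many letters on each tape, so after the
    seam the counts of both runs agree, although the times are shifted.\<close>
  have nc: "ncount l' j (a + d + r) = ncount l j (b + r)" if "j < 2" for j r
  proof -
    have "j = 0 \<or> j = 1" using that by auto
    then have "length (seg l j a b) = length (seg l j a' b')" using len out by auto
    then show ?thesis unfolding ncount_eq_length_seg seg seg' by simp
  qed
  have unb: "\<exists>n. m \<le> ncount l j (b + n)" if j: "j < 2" for j m
  proof -
    obtain n where "m \<le> ncount l j n" using inf[OF j] infinite_comp_pos_iff by blast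
    also have "\<dots> \<le> ncount l j (b + n)" by (rule ncount_mono) simp
    finally show ?thesis ..
  qed
  have inf': "infinite (comp_pos l' j)" if j: "j < 2" for j
    unfolding infinite_comp_pos_iff
  proof
    fix m
    obtain n where "m \<le> ncount l j (b + n)" using unb[OF j] by blast
    then have "m \<le> ncount l' j (a + d + n)" by (simp only: nc[OF j])
    then show "\<exists>n. m \<le> ncount l' j n" ..
  qed
  have acc': "accepting 2 T s' l'"
    using is_run_swap_segment[of T s l a a' b d] acc st inf'
    by (auto simp: accepting_def s'_def l'_def d)
  have "comp_word l' 1 = comp_word l 1"
  proof
    fix m
    obtain n where n: "Suc m \<le> ncount l 1 (b + n)" using unb[of 1 "Suc m"] by auto
    have "comp_word l' 1 m = seg l' 1 0 (a + d + n) ! m"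
      using comp_word_eq_nth_seg[OF inf'[of 1], of m "a + d + n"] n nc[of 1 n] by simp
    also have "seg l' 1 0 (a + d + n) = seg l 1 0 (b + n)"
      unfolding seg seg' by (simp only: out)
    also have "seg l 1 0 (b + n) ! m = comp_word l 1 m"
      using comp_word_eq_nth_seg[OF inf[of 1], of m "b + n"] n by simp
    finally show "comp_word l' 1 m = comp_word l 1 m" .
  qed
  then have "comp_word l' 0 = comp_word l 0"
    using inj acc acc' unfolding injective_transducer_def by blast
  \<comment> \<open>Equal input tapes and equal letter counts make the two input prefixes ending at
    the seam equal; their common beginning up to time \<open>a\<close> cancels.\<close>
  then have "seg l' 0 0 (a + d + 0) = seg l 0 0 (b + 0)"
    using nc[of 0 0] seg_eq_map_comp_word[OF inf[of 0], of "b + 0"]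
      seg_eq_map_comp_word[OF inf'[of 0], of "a + d + 0"] by simp
  then show ?thesis unfolding seg seg' by simp
qed

text \<open>A geometric sum: with at least two letters, each power dominates the sum of all smaller
  ones.\<close>

lemma card_short_words:
  assumes "2 \<le> CARD('a::finite)"
  shows "finite {w :: 'a list. length w < K}" "card {w :: 'a list. length w < K} \<le> CARD('a) ^ K"
proof -
  have "finite {w :: 'a list. length w < K} \<and> card {w :: 'a list. length w < K} \<le> CARD('a) ^ K"
  proof (induction K)
    case (Suc K)
    have eq: "{w :: 'a list. length w < Suc K} = {w. length w < K} \<union> words K" by auto
    have "card {w :: 'a list. length w < Suc K} \<le> CARD('a) ^ K + CARD('a) ^ K"
      unfolding eq using Suc card_Un_le[of "{w :: 'a list. length w < K}" "words K"]
      by (simp add: card_words)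
    also have "\<dots> \<le> CARD('a) ^ Suc K" using assms by (simp add: mult_right_mono flip: mult_2)
    finally show ?case using Suc eq by auto
  qed simp
  then show "finite {w :: 'a list. length w < K}"
    "card {w :: 'a list. length w < K} \<le> CARD('a) ^ K" by auto
qed

text \<open>On \<open>A\<close> the map \<open>f\<close> factors through \<open>key\<close>, so it
  takes no more values than there are keys.\<close>

lemma card_image_le_key:
  assumes "\<And>i i'. i \<in> A \<Longrightarrow> i' \<in> A \<Longrightarrow> key i = key i' \<Longrightarrow> f i = f i'"
    and "key ` A \<subseteq> R" "finite R"
  shows "finite (f ` A)" "card (f ` A) \<le> card R"
proof -
  define h where "h = (\<lambda>k. f (SOME i. i \<in> A \<and> key i = k))"
  have "h (key i) = f i" if "i \<in> A" for i
    using someI_ex[of "\<lambda>i'. i' \<in> A \<and> key i' = key i"] that assms(1) unfolding h_def by blast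
  then have eq: "f ` A = h ` key ` A" by (auto simp: image_image intro!: image_cong)
  have fin: "finite (key ` A)" using assms(2,3) by (rule finite_subset)
  then show "finite (f ` A)" by (simp add: eq)
  show "card (f ` A) \<le> card R"
    using card_image_le[OF fin, of h] card_mono[OF assms(3,2)] by (simp add: eq)
qed

text \<open>Few input blocks can have a short output, because such a block is determined by the states
  at its ends and by its output; by normality these blocks are rare.\<close>

lemma rho_T_run_lower_bound:
  fixes x :: "nat \<Rightarrow> 'a::finite"
  assumes nor: "normal x" and b2: "2 \<le> CARD('a)"
    and inj: "injective_transducer T" and acc: "accepting 2 T s l" and x: "comp_word l 0 = x"
    and r: "r > 0"
  shows "ereal ((1 - 1 / real r) ^ 3) \<le> rho_T_run l"
proof -
  obtain Q \<delta> I where T: "T = (Q, \<delta>, I)" by (metis prod_cases3)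
  have "is_aut 2 T" using inj by (simp add: injective_transducer_def ldet_def)
  then have finQ: "finite Q" and sub: "\<And>p \<alpha> q. (p, \<alpha>, q) \<in> \<delta> \<Longrightarrow> p \<in> Q"
    by (auto simp: is_aut_def T)
  have sQ: "s i \<in> Q" for i
    using acc sub by (auto simp: accepting_def is_run_def T)
  define b where "b = CARD('a)"
  \<comment> \<open>There are at most \<open>card Q * card Q * b ^ K\<close> keys of blocks with
    output shorter than \<open>K\<close>. As \<open>g\<close> is chosen with
    \<open>b ^ g \<ge> card Q * card Q * (2 * r)\<close> and \<open>L = K + g\<close>, they form at
    most a part 1/(2r) of all words of length \<open>L\<close>. The factor \<open>1 - 1 / r\<close>
    in the claim arises three times: from \<open>K / L\<close>, from the proportion of good blocks,
    and from the incomplete last block.\<close>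
  define g where "g = Suc (card Q * card Q * (2 * r))"
  define L where "L = r * g"
  define K where "K = (r - 1) * g"
  have L0: "L > 0" using r by (simp add: L_def g_def)
  have LK: "L = K + g" using r by (cases r) (auto simp: L_def K_def)
  have g: "card Q * card Q * (2 * r) \<le> b ^ g"
  proof -
    have "card Q * card Q * (2 * r) \<le> g" by (simp add: g_def)
    also have "g \<le> 2 ^ g" by (simp add: less_imp_le)
    also have "(2::nat) ^ g \<le> b ^ g" using b2 by (intro power_mono) (auto simp: b_def)
    finally show ?thesis .
  qed
  have inf: "infinite (comp_pos l j)" if "j < 2" for j
    using acc that by (simp add: accepting_def)
  define e where "e = enumerate (comp_pos l 0)"
  have e_mono: "m \<le> n \<Longrightarrow> e m \<le> e n" for m n
    using inf by (simp add: e_def)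
  have pre: "seg l 0 0 (e n) = map x [0..<n]" for n
    using seg_eq_map_comp_word[of l 0 "e n"] inf ncount_enumerate[of l 0 n] by (simp add: e_def x)
  \<comment> \<open>Segment \<open>i\<close> begins with the transition that reads the first letter
    of block \<open>i\<close> and includes the silent moves before the next block. Output written
    before the first letter is read lies in no segment, which is harmless for a lower bound.\<close>
  define sg where "sg i = e (i * L)" for i
  have sg_mono: "sg i \<le> sg (Suc i)" for i unfolding sg_def by (rule e_mono) simp
  have blk: "seg l 0 (sg i) (sg (Suc i)) = block L x i" for i
  proof -
    have "map x [0..<i * L] @ seg l 0 (sg i) (sg (Suc i)) = map x [0..<Suc i * L]"
      using seg_append[of 0 "sg i" "sg (Suc i)" l 0] sg_mono by (simp add: pre sg_def)
    also have "[0..<Suc i * L] = [0..<i * L] @ [i * L..<Suc i * L]"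
      using upt_add_eq_append[of 0 "i * L" L] by (simp add: add.commute)
    finally show ?thesis by (simp add: block_def)
  qed
  define out where "out i = seg l 1 (sg i) (sg (Suc i))" for i
  define bad where "bad = {i. length (out i) < K}"
  define R where "R = Q \<times> Q \<times> {w :: 'a list. length w < K}"
  have finR: "finite R" using finQ card_short_words[OF b2] by (simp add: R_def)
  have key: "finite (block L x ` bad)" "card (block L x ` bad) \<le> card R"
  proof -
    let ?key = "\<lambda>i. (s (sg i), s (sg (Suc i)), out i)"
    have *: "block L x i = block L x i'" if "?key i = ?key i'" for i i'
      unfolding blk[symmetric]
      by (rule injective_transducer_segment[OF inj acc])
        (use that in \<open>auto simp: sg_mono blk out_def\<close>)
    have **: "?key ` bad \<subseteq> R" using sQ by (auto simp: R_def bad_def)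
    show "finite (block L x ` bad)" "card (block L x ` bad) \<le> card R"
      using card_image_le_key[of bad ?key "block L x" R, OF * ** finR] by simp_all
  qed
  define B where "B = block L x ` bad"
  have finB: "finite B" using key by (simp add: B_def)
  have cardB: "real (card B) / real (b ^ L) < 1 / real r"
  proof -
    have "card B \<le> card Q * card Q * card {w :: 'a list. length w < K}"
      using key by (simp add: B_def R_def card_cartesian_product)
    also have "\<dots> \<le> card Q * card Q * b ^ K"
      using card_short_words[OF b2] by (simp add: b_def)
    finally have "card B * (2 * r) \<le> card Q * card Q * b ^ K * (2 * r)"
      by (rule mult_le_mono1)
    also have "\<dots> = card Q * card Q * (2 * r) * b ^ K" by (simp only: mult_ac)
    also have "\<dots> \<le> b ^ g * b ^ K" using g by simp
    also have "\<dots> = b ^ L" by (simp add: LK power_add)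
    finally have "real (card B * (2 * r)) \<le> real (b ^ L)" by (simp only: of_nat_le_iff)
    moreover have "real (b ^ L) > 0" using b2 by (simp add: b_def)
    ultimately have "real (card B) * (2 * real r) \<le> real (b ^ L)" "real (b ^ L) > 0"
      by (simp_all only: of_nat_mult of_nat_numeral)
    then have "real (card B) * real r < real (b ^ L)" by linarith
    then show ?thesis using r \<open>real (b ^ L) > 0\<close> by (simp add: field_simps)
  qed
  have "(\<lambda>m. \<Sum>u\<in>B. real (block_count L x u m) / real m) \<longlonglongrightarrow> (\<Sum>u\<in>B. 1 / real (b ^ L))"
    using normal_block_count[OF nor L0] by (intro tendsto_sum) (auto simp: B_def b_def)
  then have "eventually (\<lambda>m. (\<Sum>u\<in>B. real (block_count L x u m) / real m) < 1 / real r) sequentially"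
    using cardB by (intro order_tendstoD) auto
  then have ev: "eventually (\<lambda>m. (\<Sum>u\<in>B. real (block_count L x u m) / real m) < 1 / real r
      \<and> Suc m \<ge> r \<and> m > 0) sequentially"
    using eventually_gt_at_top[of 0] eventually_ge_at_top[of r]
    by eventually_elim auto
  have main: "real (ncount l 1 (sg m)) \<ge> real m * (1 - 1 / real r) * real K"
    if "(\<Sum>u\<in>B. real (block_count L x u m) / real m) < 1 / real r" "m > 0" for m
  proof -
    have "real (\<Sum>u\<in>B. block_count L x u m) / real m < 1 / real r"
      using that by (simp add: sum_divide_distrib)
    then have "real (card {i. i < m \<and> block L x i \<in> B}) < real m / real r"
      using that r finB by (simp add: sum_block_count field_simps)
    moreover have "card {i. i < m \<and> i \<in> bad} \<le> card {i. i < m \<and> block L x i \<in> B}"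
      by (rule card_mono) (auto simp: B_def)
    moreover have "m = card {i. i < m \<and> i \<in> bad} + card {i. i < m \<and> i \<notin> bad}"
    proof -
      have "{..<m} = {i. i < m \<and> i \<in> bad} \<union> {i. i < m \<and> i \<notin> bad}" by auto
      then show ?thesis
        using card_Un_disjoint[of "{i. i < m \<and> i \<in> bad}" "{i. i < m \<and> i \<notin> bad}"]
        by (metis (no_types, lifting) card_lessThan disjoint_iff finite_Un finite_lessThan mem_Collect_eq)
    qed
    ultimately have good: "real (card {i. i < m \<and> i \<notin> bad}) \<ge> real m * (1 - 1 / real r)"
      by (simp add: right_diff_distrib)
    have sum: "length (seg l 1 (sg 0) (sg m)) = (\<Sum>i<m. length (out i))" for m
    proof (induction m)
      case (Suc m)
      have "sg 0 \<le> sg m" unfolding sg_def by (rule e_mono) simp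
      then show ?case
        using Suc seg_append[of "sg 0" "sg m" "sg (Suc m)" l 1] sg_mono[of m] by (simp add: out_def)
    qed simp
    have "card {i. i < m \<and> i \<notin> bad} * K = (\<Sum>i | i < m \<and> i \<notin> bad. K)" by simp
    also have "\<dots> \<le> (\<Sum>i | i < m \<and> i \<notin> bad. length (out i))"
      by (rule sum_mono) (auto simp: bad_def)
    also have "\<dots> \<le> (\<Sum>i<m. length (out i))" by (rule sum_mono2) auto
    also have "\<dots> = length (seg l 1 (sg 0) (sg m))" by (simp only: sum)
    also have "\<dots> \<le> ncount l 1 (sg m)"
      using seg_append[of 0 "sg 0" "sg m" l 1] e_mono[of "0 * L" "m * L"]
      by (simp add: ncount_eq_length_seg sg_def)
    finally have "real (card {i. i < m \<and> i \<notin> bad}) * real K \<le> real (ncount l 1 (sg m))"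
      by (metis of_nat_le_iff of_nat_mult)
    moreover have "real m * (1 - 1 / real r) * real K \<le> real (card {i. i < m \<and> i \<notin> bad}) * real K"
      using good by (rule mult_right_mono) simp
    ultimately show ?thesis by linarith
  qed
  have K: "real K = (1 - 1 / real r) * real L"
    using r by (simp add: K_def L_def of_nat_diff field_simps)
  have "filterlim (\<lambda>n. n div L) sequentially sequentially"
    unfolding filterlim_at_top
  proof
    fix Z
    show "eventually (\<lambda>n. Z \<le> n div L) sequentially"
      using eventually_ge_at_top[of "Z * L"]
      by eventually_elim (use L0 in \<open>simp add: less_eq_div_iff_mult_less_eq\<close>)
  qed
  then have "eventually (\<lambda>n. (\<Sum>u\<in>B. real (block_count L x u (n div L)) / real (n div L)) < 1 / real r
      \<and> Suc (n div L) \<ge> r \<and> n div L > 0) sequentially"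
    by (rule eventually_compose_filterlim[OF ev])
  then have "eventually (\<lambda>n. ereal ((1 - 1 / real r) ^ 3) \<le>
      ereal (real (ncount l 1 (e n + 1)) / real (Suc n))) sequentially"
  proof eventually_elim
    case (elim n)
    define m where "m = n div L"
    define t where "t = 1 - 1 / real r"
    have t: "0 \<le> t" using r by (simp add: t_def)
    have "real (Suc n) \<le> real (Suc m) * real L"
    proof -
      have "n < Suc m * L" using L0 unfolding m_def
        by (metis dividend_less_div_times mult_Suc add.commute)
      then have "Suc n \<le> Suc m * L" by simp
      then show ?thesis by (metis of_nat_le_iff of_nat_mult)
    qed
    then have "t ^ 3 * real (Suc n) \<le> t ^ 3 * (real (Suc m) * real L)"
      using t by (intro mult_left_mono) auto
    also have "\<dots> = (t * real (Suc m)) * (t * t * real L)" by (simp add: power3_eq_cube)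
    \<comment> \<open>The third factor pays for the letters after the last complete block:
      \<open>t * (m + 1) \<le> m\<close> as soon as \<open>m + 1 \<ge> r\<close>.\<close>
    also have "\<dots> \<le> real m * (t * t * real L)"
    proof (rule mult_right_mono)
      have "real r \<le> real (Suc m)" using elim by (simp only: m_def of_nat_le_iff)
      then have "1 \<le> real (Suc m) / real r" using r by simp
      then show "t * real (Suc m) \<le> real m" by (simp add: t_def left_diff_distrib)
    qed (use t in simp)
    also have "\<dots> = real m * (1 - 1 / real r) * real K" by (simp add: K t_def)
    also have "\<dots> \<le> real (ncount l 1 (sg m))" using main[of m] elim by (simp add: m_def)
    also have "\<dots> \<le> real (ncount l 1 (e n + 1))"
    proof -
      have "sg m \<le> e n" unfolding sg_def by (rule e_mono) (simp add: m_def)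
      then show ?thesis using ncount_mono[of "sg m" "e n + 1" l 1] by simp
    qed
    finally have "t ^ 3 \<le> real (ncount l 1 (e n + 1)) / real (Suc n)"
      by (simp add: le_divide_eq)
    then show ?case by (simp add: t_def)
  qed
  then show ?thesis unfolding rho_T_run_def e_def by (intro Liminf_bounded) simp
qed

theorem normal_imp_rho_ge_1:
  fixes x :: "nat \<Rightarrow> 'a::finite"
  assumes "normal x" "2 \<le> CARD('a)"
  shows "1 \<le> rho x"
proof -
  have "1 \<le> rho_T_run l"
    if "injective_transducer T" "accepting 2 T s l" "comp_word l 0 = x" for T s l
  proof -
    have "(\<lambda>r. (1 - 1 / real r) ^ 3) \<longlonglongrightarrow> (1 - 0) ^ 3"
      by (intro tendsto_intros lim_const_over_n)
    then have "(\<lambda>r. ereal ((1 - 1 / real r) ^ 3)) \<longlonglongrightarrow> ereal ((1 - 0) ^ 3)"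
      by (intro tendsto_ereal)
    moreover have "eventually (\<lambda>r. ereal ((1 - 1 / real r) ^ 3) \<le> rho_T_run l) sequentially"
      using eventually_gt_at_top[of 0]
      by eventually_elim (rule rho_T_run_lower_bound[OF assms that])
    ultimately have "ereal ((1 - 0) ^ 3) \<le> rho_T_run l"
      by (intro tendsto_upperbound) auto
    then show ?thesis by (simp add: one_ereal_def)
  qed
  then show ?thesis unfolding rho_def by (intro Inf_greatest) auto
qed

section \<open>Prefix codes with side information\<close>

text \<open>Kraft's inequality, by greedy choice in order of increasing length: when
  \<open>x\<close> is treated, the words of length \<open>len x\<close> that extend earlier code
  words are fewer than all words of that length, so one remains free.\<close>

lemma kraft_prefix_code:
  fixes len :: "'b \<Rightarrow> nat"
  assumes "finite S" and "(\<Sum>s\<in>S. 1 / real (CARD('a::finite) ^ len s)) \<le> 1"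
  shows "\<exists>c :: 'b \<Rightarrow> 'a list. (\<forall>s\<in>S. length (c s) = len s) \<and>
    (\<forall>s\<in>S. \<forall>t\<in>S. prefix (c s) (c t) \<longrightarrow> s = t)"
  using assms
proof (induction S rule: finite_ranking_induct[where f = len])
  case empty
  show ?case by simp
next
  case (insert x S)
  let ?b = "CARD('a)"
  show ?case
  proof (cases "x \<in> S")
    case True
    then show ?thesis using insert by (simp add: insert_absorb)
  next
    case False
    have b: "?b > 0" by simp
    have sum: "1 / real (?b ^ len x) + (\<Sum>s\<in>S. 1 / real (?b ^ len s)) \<le> 1"
      using insert.prems insert.hyps False by simp
    moreover have "0 \<le> 1 / real (?b ^ len x)" by simp
    ultimately have "(\<Sum>s\<in>S. 1 / real (?b ^ len s)) \<le> 1" by linarith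
    then obtain c :: "'b \<Rightarrow> 'a list" where c: "\<forall>s\<in>S. length (c s) = len s"
        "\<forall>s\<in>S. \<forall>t\<in>S. prefix (c s) (c t) \<longrightarrow> s = t"
      using insert.IH by blast
    define E where "E t = (\<lambda>z. c t @ z) ` (words (len x - len t) :: 'a list set)" for t
    have finE: "finite (\<Union>t\<in>S. E t)" using insert.hyps by (simp add: E_def)
    have "card (\<Union>t\<in>S. E t) \<le> (\<Sum>t\<in>S. card (E t))"
      using insert.hyps by (intro card_UN_le)
    also have "\<dots> \<le> (\<Sum>t\<in>S. ?b ^ (len x - len t))"
    proof (rule sum_mono)
      fix t
      show "card (E t) \<le> ?b ^ (len x - len t)"
        unfolding E_def card_words[symmetric] by (rule card_image_le) simp
    qed
    finally have "real (card (\<Union>t\<in>S. E t)) \<le> real (\<Sum>t\<in>S. ?b ^ (len x - len t))"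
      by (simp only: of_nat_le_iff)
    also have "\<dots> = (\<Sum>t\<in>S. real (?b ^ (len x - len t)))" by (simp only: of_nat_sum)
    also have "\<dots> = (\<Sum>t\<in>S. real (?b ^ len x) * (1 / real (?b ^ len t)))"
    proof (rule sum.cong)
      fix t assume "t \<in> S"
      then have "len t \<le> len x" using insert.hyps(2) by simp
      then have "?b ^ len x = ?b ^ (len x - len t) * ?b ^ len t" by (simp flip: power_add)
      then have "real (?b ^ len x) = real (?b ^ (len x - len t)) * real (?b ^ len t)"
        by (simp only: of_nat_mult)
      then show "real (?b ^ (len x - len t)) = real (?b ^ len x) * (1 / real (?b ^ len t))"
        by simp
    qed simp
    also have "\<dots> = real (?b ^ len x) * (\<Sum>t\<in>S. 1 / real (?b ^ len t))"
      by (simp only: sum_distrib_left)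
    also have "\<dots> \<le> real (?b ^ len x) * (1 - 1 / real (?b ^ len x))"
      using sum by (intro mult_left_mono) auto
    also have "\<dots> < real (?b ^ len x)"
      by (simp add: right_diff_distrib)
    finally have "card (\<Union>t\<in>S. E t) < card (words (len x) :: 'a list set)"
      by (simp add: card_words)
    then have "\<not> words (len x) \<subseteq> (\<Union>t\<in>S. E t)"
      using card_mono[OF finE, of "words (len x)"] by linarith
    then obtain w where w: "length w = len x" "w \<notin> (\<Union>t\<in>S. E t)" by (auto simp: subset_iff)
    have not1: "\<not> prefix (c t) w" if "t \<in> S" for t
    proof
      assume "prefix (c t) w"
      then obtain z where z: "w = c t @ z" by (auto elim: prefixE)
      then have "length z = len x - len t" using w c that by auto
      then have "w \<in> E t" by (simp add: E_def z)
      then show False using w that by auto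
    qed
    \<comment> \<open>The new word is at least as long as the earlier ones, so being a prefix of one
      of them would mean equality, which \<open>not1\<close> excludes.\<close>
    have not2: "\<not> prefix w (c t)" if "t \<in> S" for t
    proof
      assume p: "prefix w (c t)"
      then have "len x \<le> len t" using w c that prefix_length_le[of w "c t"] by auto
      then have "length (c t) = length w" using insert.hyps(2)[OF that] c that w by auto
      then have "c t = w" using p by (auto elim: prefixE)
      then show False using not1[OF that] by simp
    qed
    have ne: "t \<noteq> x" if "t \<in> S" for t using that False by auto
    let ?c = "c(x := w)"
    have cS: "?c t = c t" if "t \<in> S" for t using ne[OF that] by simp
    have "length (?c s) = len s" if "s \<in> insert x S" for s
      using that w(1) c(1) cS by (cases "s = x") auto
    moreover have "s = t" if "s \<in> insert x S" "t \<in> insert x S" "prefix (?c s) (?c t)" for s t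
    proof -
      consider "s = x" "t = x" | "s = x" "t \<in> S" | "s \<in> S" "t = x" | "s \<in> S" "t \<in> S"
        using \<open>s \<in> insert x S\<close> \<open>t \<in> insert x S\<close> by blast
      then show ?thesis
      proof cases
        case 2
        then show ?thesis using not2[of t] cS[of t] that(3) by simp
      next
        case 3
        then show ?thesis using not1[of s] cS[of s] that(3) by simp
      next
        case 4
        then show ?thesis using c(2) cS that(3) by metis
      qed simp
    qed
    ultimately show ?thesis by blast
  qed
qed

definition chunk :: "nat \<Rightarrow> nat \<Rightarrow> 'a list \<Rightarrow> 'a list" where
  "chunk l i xs = take l (drop (i * l) xs)"

lemma words_add: "words (m + n) = (\<lambda>(xs, ys). xs @ ys) ` (words m \<times> words n)"
proof (intro equalityI subsetI)
  fix w :: "'a list" assume "w \<in> words (m + n)"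
  then have "(take m w, drop m w) \<in> words m \<times> words n" by simp
  then have "(\<lambda>(xs, ys). xs @ ys) (take m w, drop m w) \<in> (\<lambda>(xs, ys). xs @ ys) ` (words m \<times> words n)"
    by (rule imageI)
  then show "w \<in> (\<lambda>(xs, ys). xs @ ys) ` (words m \<times> words n)" by simp
qed auto

text \<open>A product of conditional subprobabilities is again one: splitting off the first chunk
  turns the sum into a product of two sums.\<close>

lemma sum_prod_chunks_le_1:
  fixes q :: "'a::finite list \<Rightarrow> 'a list \<Rightarrow> real"
  assumes nonneg: "\<And>X Y. 0 \<le> q X Y"
    and one: "\<And>Y. length Y = l \<Longrightarrow> (\<Sum>X\<in>words l. q X Y) \<le> 1"
  shows "length Y = k * l \<Longrightarrow> (\<Sum>X\<in>words (k * l). \<Prod>i<k. q (chunk l i X) (chunk l i Y)) \<le> 1"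
proof (induction k arbitrary: Y)
  case 0
  have "words 0 = {[] :: 'a list}" by (auto simp: words_def)
  then show ?case by simp
next
  case (Suc k)
  define Y1 Y2 where "Y1 = take l Y" and "Y2 = drop l Y"
  have len: "length Y1 = l" "length Y2 = k * l" using Suc.prems by (auto simp: Y1_def Y2_def)
  let ?f = "\<lambda>X. \<Prod>i<Suc k. q (chunk l i X) (chunk l i Y)"
  have f: "?f (X1 @ X2) = q X1 Y1 * (\<Prod>i<k. q (chunk l i X2) (chunk l i Y2))"
    if "length X1 = l" for X1 X2
    using that by (simp add: prod.lessThan_Suc_shift chunk_def Y1_def Y2_def drop_drop add.commute
        del: prod.lessThan_Suc)
  have inj: "inj_on (\<lambda>(xs, ys). xs @ ys) (words l \<times> words (k * l) :: ('a list \<times> 'a list) set)"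
    by (auto simp: inj_on_def)
  have "(\<Sum>X\<in>words (Suc k * l). ?f X) = (\<Sum>(X1, X2)\<in>words l \<times> words (k * l). ?f (X1 @ X2))"
    using words_add[of l "k * l", where 'a = 'a] sum.reindex[OF inj, of ?f]
    by (simp add: comp_def case_prod_unfold del: prod.lessThan_Suc)
  also have "\<dots> = (\<Sum>X1\<in>words l. \<Sum>X2\<in>words (k * l).
      q X1 Y1 * (\<Prod>i<k. q (chunk l i X2) (chunk l i Y2)))"
    unfolding sum.cartesian_product by (intro sum.cong) (auto simp: f simp del: prod.lessThan_Suc)
  also have "\<dots> = (\<Sum>X1\<in>words l. q X1 Y1) *
      (\<Sum>X2\<in>words (k * l). \<Prod>i<k. q (chunk l i X2) (chunk l i Y2))"
    by (simp only: sum_product)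
  also have "\<dots> \<le> 1 * 1"
    using one[OF len(1)] Suc.IH[OF len(2)]
    by (intro mult_mono sum_nonneg prod_nonneg) (auto simp: nonneg)
  finally show ?case by simp
qed

text \<open>Shannon coding, with the second components of the pairs as side information known to both
  the encoder and the decoder.\<close>

lemma conditional_prefix_code:
  fixes q :: "'a::finite list \<Rightarrow> 'a list \<Rightarrow> real"
  assumes b2: "2 \<le> CARD('a)" and pos: "\<And>X Y. 0 < q X Y"
    and one: "\<And>Y. length Y = l \<Longrightarrow> (\<Sum>X\<in>words l. q X Y) \<le> 1"
  obtains C :: "('a \<times> 'a) list \<Rightarrow> 'a list" where
    "\<And>P. length P = k * l \<Longrightarrow> C P \<noteq> []"
    "\<And>P. length P = k * l \<Longrightarrow> real (length (C P)) \<le>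
      1 - (\<Sum>i<k. log (real CARD('a)) (q (map fst (chunk l i P)) (map snd (chunk l i P))))"
    "\<And>P P'. length P = k * l \<Longrightarrow> length P' = k * l \<Longrightarrow> map snd P = map snd P' \<Longrightarrow>
      prefix (C P) (C P') \<Longrightarrow> P = P'"
proof -
  let ?b = "real CARD('a)"
  have b: "?b > 1" using b2 by simp
  define wt where "wt X Y = (\<Prod>i<k. q (chunk l i X) (chunk l i Y))" for X Y
  have wt_pos: "wt X Y > 0" for X Y unfolding wt_def by (intro prod_pos) (simp add: pos)
  \<comment> \<open>Floor plus one instead of the ceiling: it still exceeds the ideal length by at
    most one letter, and it is never 0. Nonempty code words are what later makes the output tape
    infinite.\<close>
  define len where "len X Y = nat (\<lfloor>- log ?b (wt X Y)\<rfloor> + 1)" for X Y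
  have sum1: "(\<Sum>X\<in>words (k * l). wt X Y) \<le> 1" if "length Y = k * l" for Y
    unfolding wt_def by (rule sum_prod_chunks_le_1[OF _ one that]) (simp add: pos less_imp_le)
  have wt_le: "wt X Y \<le> 1" if "length X = k * l" "length Y = k * l" for X Y
    using member_le_sum[of X "words (k * l)" "\<lambda>X. wt X Y"] sum1[OF that(2)] that(1) wt_pos
    by (force simp: less_imp_le)
  have "\<exists>c :: 'a list \<Rightarrow> 'a list. (\<forall>X\<in>words (k * l). length (c X) = len X Y) \<and>
      (\<forall>s\<in>words (k * l). \<forall>t\<in>words (k * l). prefix (c s) (c t) \<longrightarrow> s = t)"
    if Y: "length Y = k * l" for Y
  proof (rule kraft_prefix_code)
    have "1 / real (CARD('a) ^ len X Y) \<le> wt X Y" if "length X = k * l" for X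
    proof -
      have "- log ?b (wt X Y) \<le> real (len X Y)"
        unfolding len_def by linarith
      then have "?b powr (- real (len X Y)) \<le> ?b powr (log ?b (wt X Y))"
        using b by (intro powr_mono) auto
      also have "\<dots> = wt X Y" using b wt_pos by simp
      finally show ?thesis using b by (simp add: powr_minus powr_realpow divide_inverse)
    qed
    then have "(\<Sum>X\<in>words (k * l). 1 / real (CARD('a) ^ len X Y)) \<le> (\<Sum>X\<in>words (k * l). wt X Y)"
      by (intro sum_mono) auto
    then show "(\<Sum>X\<in>words (k * l). 1 / real (CARD('a) ^ len X Y)) \<le> 1"
      using sum1[OF Y] by linarith
  qed simp
  then obtain c :: "'a list \<Rightarrow> 'a list \<Rightarrow> 'a list"
    where c1: "\<And>X Y. length Y = k * l \<Longrightarrow> length X = k * l \<Longrightarrow> length (c Y X) = len X Y"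
      and c2: "\<And>X X' Y. length Y = k * l \<Longrightarrow> length X = k * l \<Longrightarrow> length X' = k * l \<Longrightarrow>
        prefix (c Y X) (c Y X') \<Longrightarrow> X = X'"
    unfolding words_iff Ball_def by metis
  define C where "C P = c (map snd P) (map fst P)" for P
  have ch: "map fst (chunk l i P) = chunk l i (map fst P)"
    "map snd (chunk l i P) = chunk l i (map snd P)" for i and P :: "('a \<times> 'a) list"
    by (simp_all add: chunk_def take_map drop_map)
  have log_wt: "log ?b (wt X Y) = (\<Sum>i<k. log ?b (q (chunk l i X) (chunk l i Y)))" for X Y
  proof -
    have "log ?b (\<Prod>i<n. q (chunk l i X) (chunk l i Y)) =
        (\<Sum>i<n. log ?b (q (chunk l i X) (chunk l i Y)))" for n
    proof (induction n)
      case (Suc n)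
      have "(\<Prod>i<n. q (chunk l i X) (chunk l i Y)) > 0" by (intro prod_pos) (simp add: pos)
      then show ?case using Suc b pos by (simp add: log_mult_pos)
    qed simp
    then show ?thesis by (simp add: wt_def)
  qed
  show thesis
  proof (rule that[of C])
    fix P :: "('a \<times> 'a) list" assume P: "length P = k * l"
    let ?w = "wt (map fst P) (map snd P)"
    have len: "length (C P) = len (map fst P) (map snd P)" using P by (simp add: C_def c1)
    \<comment> \<open>Weights at most 1 have a nonnegative ideal length, so \<open>nat\<close>
      truncates nothing.\<close>
    have "?w \<le> 1" "?w > 0" using wt_le wt_pos P by auto
    then have "- log ?b ?w \<ge> 0" using b by (simp add: log_le_zero_cancel_iff)
    then have "\<lfloor>- log ?b ?w\<rfloor> \<ge> 0" by (simp only: zero_le_floor)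
    then have l: "length (C P) \<ge> 1" "real (length (C P)) = of_int \<lfloor>- log ?b ?w\<rfloor> + 1"
      unfolding len len_def by linarith+
    show "C P \<noteq> []" using l by auto
    show "real (length (C P)) \<le>
      1 - (\<Sum>i<k. log ?b (q (map fst (chunk l i P)) (map snd (chunk l i P))))"
      using l(2) of_int_floor_le[of "- log ?b ?w"] by (simp add: ch log_wt)
  next
    fix P P' :: "('a \<times> 'a) list"
    assume *: "length P = k * l" "length P' = k * l" "map snd P = map snd P'" "prefix (C P) (C P')"
    then have "map fst P = map fst P'"
      using c2[of "map snd P" "map fst P" "map fst P'"] by (simp add: C_def)
    with * show "P = P'" by (metis zip_map_fst_snd)
  qed
qed

section \<open>Compressors from prefix codes\<close>

text \<open>Unique decoding block by block: the first code words are both prefixes of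
  \<open>w\<close>, hence comparable, and with equal second components prefix-freeness makes the two
  blocks equal. Then the common code word is removed from \<open>w\<close>.\<close>

lemma prefix_code_concat_cancel:
  assumes pf: "\<And>P P'. length P = L \<Longrightarrow> length P' = L \<Longrightarrow> map snd P = map snd P' \<Longrightarrow>
      prefix (C P) (C P') \<Longrightarrow> P = P'"
    and "length Ps = length Ps'"
    and "prefix (concat (map C Ps)) w" "prefix (concat (map C Ps')) w"
    and "\<forall>P\<in>set Ps. length P = L" "\<forall>P\<in>set Ps'. length P = L"
    and "map (map snd) Ps = map (map snd) Ps'"
  shows "Ps = Ps'"
  using assms(2-)
proof (induction Ps Ps' arbitrary: w rule: list_induct2)
  case Nil
  then show ?case by simp
next
  case (Cons P Ps P' Ps')
  have p: "prefix (C P) w" "prefix (C P') w"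
    using Cons.prems(1,2) by (auto dest: append_prefixD)
  then have "prefix (C P) (C P') \<or> prefix (C P') (C P)"
    using prefix_same_cases by blast
  then have eq: "P = P'" using pf[of P P'] pf[of P' P] Cons.prems by auto
  obtain w' where w': "w = C P @ w'" using p(1) by (auto elim: prefixE)
  have "Ps = Ps'"
    using Cons.prems by (intro Cons.IH[of w']) (auto simp: w' eq)
  with eq show ?case by simp
qed

text \<open>States of automata are natural numbers, so configurations are numbered
  injectively.\<close>

definition enc :: "('a::finite \<times> 'a) list \<times> 'a list \<Rightarrow> nat" where
  "enc = to_nat"

lemma enc_eq_iff [simp]: "enc s = enc t \<longleftrightarrow> s = t"
  by (simp add: enc_def)

definition next_conf :: "nat \<Rightarrow> (('a \<times> 'a) list \<Rightarrow> 'a list) \<Rightarrow> ('a \<times> 'a) list \<Rightarrow> 'a \<times> 'a \<Rightarrow>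
    ('a \<times> 'a) list \<times> 'a list" where
  "next_conf L C P z = (if Suc (length P) = L then ([], C (P @ [z])) else (P @ [z], []))"

text \<open>A state consists of the pairs of letters read so far in the current block of length \<open>L\<close>, and
  of the part of the code word of the previous block that still has to be written.\<close>

definition code_trans :: "nat \<Rightarrow> (('a::finite \<times> 'a) list \<Rightarrow> 'a list) \<Rightarrow>
    (nat \<times> 'a option list \<times> nat) set" where
  "code_trans L C =
    {(enc (P, []), [Some a, Some b, None], enc (next_conf L C P (a, b))) | P a b. length P < L} \<union>
    {(enc ([], z # O'), [None, None, Some z], enc ([], O')) | z O'.
      length O' < Max (insert 0 ((length \<circ> C) ` words L))}"

text \<open>Bounding the pending output by the longest code word makes the state set finite.\<close>

definition code_states :: "nat \<Rightarrow> (('a::finite \<times> 'a) list \<Rightarrow> 'a list) \<Rightarrow> nat set" where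
  "code_states L C = enc ` ({P :: ('a \<times> 'a) list. length P < L} \<times>
    {O'. length O' \<le> Max (insert 0 ((length \<circ> C) ` words L))})"

definition code_aut :: "nat \<Rightarrow> (('a::finite \<times> 'a) list \<Rightarrow> 'a list) \<Rightarrow> 'a aut" where
  "code_aut L C = (code_states L C, code_trans L C, {enc ([] :: ('a \<times> 'a) list, [])})"

lemma length_code_le:
  fixes C :: "('a::finite \<times> 'a) list \<Rightarrow> 'a list"
  shows "length P = L \<Longrightarrow> length (C P) \<le> Max (insert 0 ((length \<circ> C) ` words L))"
  by (rule Max_ge) auto

lemma code_trans_read:
  "(enc (P, []), \<alpha>, q) \<in> code_trans L C \<Longrightarrow>
    \<exists>a b. \<alpha> = [Some a, Some b, None] \<and> q = enc (next_conf L C P (a, b))"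
  unfolding code_trans_def by auto

lemma code_trans_write:
  "(enc (P, z # O'), \<alpha>, q) \<in> code_trans L C \<Longrightarrow>
    \<alpha> = [None, None, Some z] \<and> q = enc ([], O')"
  unfolding code_trans_def by auto

text \<open>Whether output is pending decides if a state reads on both input tapes or on neither,
  and the next state is a function of the letters read.\<close>

lemma ldet_code_aut:
  fixes C :: "('a::finite \<times> 'a) list \<Rightarrow> 'a list"
  assumes "L > 0"
  shows "ldet 2 3 (code_aut L C)"
proof -
  let ?M = "Max (insert 0 ((length \<circ> C) ` words L))"
  have fin: "finite {P :: 'b::finite list. length P \<le> n}" for n
    using finite_lists_length_le[of "UNIV :: 'b set" n] by simp
  have "finite {P :: ('a \<times> 'a) list. length P < L}"
    by (rule finite_subset[OF _ fin[of L]]) auto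
  then have "finite (code_states L C)" unfolding code_states_def using fin[of ?M]
    by (intro finite_imageI finite_cartesian_product)
  moreover have "enc ([] :: ('a \<times> 'a) list, []) \<in> code_states L C" using assms by (auto simp: code_states_def)
  moreover have "p \<in> code_states L C \<and> q \<in> code_states L C \<and> length \<alpha> = 3"
    if "(p, \<alpha>, q) \<in> code_trans L C" for p \<alpha> q
    using that unfolding code_trans_def
  proof (elim UnE CollectE exE conjE)
    fix P a b assume *: "(p, \<alpha>, q) = (enc (P, []), [Some a, Some b, None],
      enc (next_conf L C P (a, b)))" and P: "length P < L"
    have "p \<in> code_states L C" using * P by (auto simp: code_states_def)
    moreover have "q \<in> code_states L C"
      using * P assms length_code_le[of "P @ [(a, b)]" L C]
      by (auto simp: code_states_def next_conf_def)
    ultimately show ?thesis using * by simp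
  next
    fix z O' assume *: "(p, \<alpha>, q) = (enc ([], z # O'), [None, None, Some z], enc ([], O'))"
      and "length O' < ?M"
    then show ?thesis using assms by (auto simp: code_states_def)
  qed
  ultimately have aut: "is_aut 3 (code_aut L C)"
    unfolding is_aut_def code_aut_def prod.case by (intro conjI ballI) (auto split: prod.split)
  have det: "(\<forall>j<2. \<alpha> ! j = None \<longrightarrow> \<alpha>' ! j = None) \<and>
      ((\<forall>i<2. \<alpha> ! i = \<alpha>' ! i) \<longrightarrow> (\<forall>i. 2 \<le> i \<and> i < 3 \<longrightarrow> \<alpha> ! i = \<alpha>' ! i) \<and> q = q')"
    if tr: "(p, \<alpha>, q) \<in> code_trans L C" "(p, \<alpha>', q') \<in> code_trans L C" for p \<alpha> q \<alpha>' q'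
  proof -
    have two: "(\<forall>i<2. R i) \<longleftrightarrow> R 0 \<and> R 1" for R :: "nat \<Rightarrow> bool"
      by (auto simp: numeral_2_eq_2 All_less_Suc)
    have "2 \<le> i \<and> i < 3 \<longleftrightarrow> i = 2" for i :: nat by auto
    then have three: "(\<forall>i. 2 \<le> i \<and> i < 3 \<longrightarrow> R i) \<longleftrightarrow> R (2 :: nat)" for R by simp
    consider P :: "('a \<times> 'a) list" where "p = enc (P, [])" | z :: 'a and O' where "p = enc ([], z # O')"
      using tr(1) unfolding code_trans_def by blast
    then show ?thesis
    proof cases
      case 1
      obtain a b where ab: "\<alpha> = [Some a, Some b, None]" "q = enc (next_conf L C P (a, b))"
        using code_trans_read[OF tr(1)[unfolded 1]] by blast
      obtain a' b' where ab': "\<alpha>' = [Some a', Some b', None]" "q' = enc (next_conf L C P (a', b'))"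
        using code_trans_read[OF tr(2)[unfolded 1]] by blast
      show ?thesis unfolding two three ab ab' by simp
    next
      case 2
      have "\<alpha> = \<alpha>'" "q = q'"
        using code_trans_write[OF tr(1)[unfolded 2]] code_trans_write[OF tr(2)[unfolded 2]] by simp_all
      then show ?thesis by simp
    qed
  qed
  have "\<exists>q0. {enc ([] :: ('a \<times> 'a) list, [])} = {q0}" by simp
  with aut det show ?thesis unfolding ldet_def code_aut_def prod.case by blast
qed

lemma ncount_Suc: "ncount l j (Suc n) = ncount l j n + (if l n ! j = None then 0 else 1)"
  by (auto simp: ncount_eq_length_seg seg_Suc split: option.split)

section \<open>Runs of the code automaton\<close>

lemma code_run_step:
  fixes C :: "('a::finite \<times> 'a) list \<Rightarrow> 'a list"
  assumes "is_run (code_aut L C) s l"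
  shows "s n = enc (P, []) \<Longrightarrow>
      \<exists>a b. l n = [Some a, Some b, None] \<and> s (Suc n) = enc (next_conf L C P (a, b))"
    and "s n = enc (P, z # O') \<Longrightarrow> l n = [None, None, Some z] \<and> s (Suc n) = enc ([], O')"
proof -
  have "(s n, l n, s (Suc n)) \<in> code_trans L C" using assms by (simp add: is_run_def code_aut_def)
  then show "s n = enc (P, []) \<Longrightarrow>
      \<exists>a b. l n = [Some a, Some b, None] \<and> s (Suc n) = enc (next_conf L C P (a, b))"
    and "s n = enc (P, z # O') \<Longrightarrow> l n = [None, None, Some z] \<and> s (Suc n) = enc ([], O')"
    using code_trans_read[of P "l n"] code_trans_write[of P z O' "l n"] by metis+
qed

lemma code_run_write:
  fixes C :: "('a::finite \<times> 'a) list \<Rightarrow> 'a list"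
  assumes "is_run (code_aut L C) s l"
  shows "s t = enc ([], O') \<Longrightarrow> s (t + length O') = enc ([] :: ('a \<times> 'a) list, []) \<and>
    ncount l 0 (t + length O') = ncount l 0 t \<and> ncount l 1 (t + length O') = ncount l 1 t \<and>
    seg l 2 t (t + length O') = O'"
proof (induction O' arbitrary: t)
  case (Cons z O')
  have step: "l t = [None, None, Some z]" "s (Suc t) = enc ([], O')"
    using code_run_step(2)[OF assms Cons.prems] by auto
  have "seg l 2 t (Suc t) = [z]" using seg_Suc[of t t l 2] step by simp
  then have "seg l 2 t (Suc t + length O') = z # seg l 2 (Suc t) (Suc t + length O')"
    using seg_append[of t "Suc t" "Suc t + length O'" l 2] by simp
  then show ?case using Cons.IH[OF step(2)] step(1) by (simp add: ncount_Suc)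
qed simp

text \<open>Both tapes are read in lockstep and nothing is written; on the last letter, at
  \<open>r = L\<close>, the stored block gives way to its code word.\<close>

lemma code_run_read:
  fixes C :: "('a::finite \<times> 'a) list \<Rightarrow> 'a list"
  assumes run: "is_run (code_aut L C) s l"
    and x: "\<And>i a. l i ! 0 = Some a \<Longrightarrow> a = x (ncount l 0 i)"
    and y: "\<And>i a. l i ! 1 = Some a \<Longrightarrow> a = y (ncount l 1 i)"
    and t: "s t = enc ([] :: ('a \<times> 'a) list, [])" "ncount l 0 t = m" "ncount l 1 t = m"
  shows "r \<le> L \<Longrightarrow> L > 0 \<Longrightarrow> s (t + r) = enc
      (if r < L then (map (\<lambda>j. (x j, y j)) [m..<m + r], []) else ([], C (map (\<lambda>j. (x j, y j)) [m..<m + r])))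
    \<and> ncount l 0 (t + r) = m + r \<and> ncount l 1 (t + r) = m + r \<and> seg l 2 t (t + r) = []"
proof (induction r)
  case 0
  then show ?case using t by simp
next
  case (Suc r)
  let ?P = "map (\<lambda>j. (x j, y j)) [m..<m + r]"
  from Suc have IH: "s (t + r) = enc (?P, [])" "ncount l 0 (t + r) = m + r"
    "ncount l 1 (t + r) = m + r" "seg l 2 t (t + r) = []" by auto
  obtain a b where ab: "l (t + r) = [Some a, Some b, None]"
    "s (Suc (t + r)) = enc (next_conf L C ?P (a, b))"
    using code_run_step(1)[OF run IH(1)] by blast
  have "a = x (m + r)" "b = y (m + r)"
    using x[of "t + r" a] y[of "t + r" b] ab(1) IH by simp_all
  then have "s (Suc (t + r)) = enc (next_conf L C ?P (x (m + r), y (m + r)))" using ab by simp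
  moreover have "seg l 2 t (Suc (t + r)) = []" using IH(4) ab(1) by (simp add: seg_Suc)
  ultimately show ?case
    using ab(1) IH Suc.prems by (auto simp: ncount_Suc next_conf_def)
qed

text \<open>Each block takes \<open>L\<close> reading moves followed by the writing of its code
  word. The tapes enter only through their letters as they are read, so the lemma applies both to
  accepting runs and to a constructed run not yet known to be accepting.\<close>

lemma code_run_blocks:
  fixes C :: "('a::finite \<times> 'a) list \<Rightarrow> 'a list"
  assumes run: "is_run (code_aut L C) s l" and L: "L > 0"
    and x: "\<And>i a. l i ! 0 = Some a \<Longrightarrow> a = x (ncount l 0 i)"
    and y: "\<And>i a. l i ! 1 = Some a \<Longrightarrow> a = y (ncount l 1 i)"
  shows "\<exists>t. s t = enc ([] :: ('a \<times> 'a) list, []) \<and> ncount l 0 t = M * L \<and> ncount l 1 t = M * L \<and>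
    seg l 2 0 t = concat (map C (map (block L (\<lambda>j. (x j, y j))) [0..<M]))"
proof (induction M)
  case 0
  have "s 0 = enc ([] :: ('a \<times> 'a) list, [])" using run by (simp add: is_run_def code_aut_def)
  then show ?case by (intro exI[of _ 0]) (simp add: ncount_def)
next
  case (Suc M)
  then obtain t where t: "s t = enc ([] :: ('a \<times> 'a) list, [])" "ncount l 0 t = M * L" "ncount l 1 t = M * L"
    "seg l 2 0 t = concat (map C (map (block L (\<lambda>j. (x j, y j))) [0..<M]))" by blast
  let ?B = "C (block L (\<lambda>j. (x j, y j)) M)"
  define t1 t2 where "t1 = t + L" and "t2 = t1 + length ?B"
  have B: "block L (\<lambda>j. (x j, y j)) M = map (\<lambda>j. (x j, y j)) [M * L..<M * L + L]"
    by (simp add: block_def add.commute)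
  have 1: "s t1 = enc ([], ?B)" "ncount l 0 t1 = M * L + L" "ncount l 1 t1 = M * L + L"
    "seg l 2 t t1 = []"
    using code_run_read[where x = x and y = y and r = L, OF run x y t(1-3)] L unfolding t1_def B by auto
  have 2: "s t2 = enc ([] :: ('a \<times> 'a) list, [])" "ncount l 0 t2 = M * L + L" "ncount l 1 t2 = M * L + L"
    "seg l 2 t1 t2 = ?B"
    using code_run_write[OF run 1(1)] 1 unfolding t2_def by auto
  have "seg l 2 0 t2 = seg l 2 0 t @ ?B"
    using seg_append[of 0 t t2 l 2] seg_append[of t t1 t2 l 2] 1(4) 2(4)
    by (simp add: t1_def t2_def)
  then show ?case using 2 t(4) by (intro exI[of _ t2]) simp
qed

text \<open>Two runs with the same oracle and output are compared after the block containing
  position \<open>m\<close>: both lists of code words spell prefixes of the same output and belong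
  to the same oracle blocks, so decoding is unique.\<close>

lemma compressor_code_aut:
  fixes C :: "('a::finite \<times> 'a) list \<Rightarrow> 'a list"
  assumes L: "L > 0"
    and pf: "\<And>P P'. length P = L \<Longrightarrow> length P' = L \<Longrightarrow> map snd P = map snd P' \<Longrightarrow>
      prefix (C P) (C P') \<Longrightarrow> P = P'"
  shows "compressor (code_aut L C)"
  unfolding compressor_def
proof (intro conjI allI impI)
  show "ldet 2 3 (code_aut L C)" by (rule ldet_code_aut[OF L])
next
  fix s l s' l'
  assume acc: "accepting 3 (code_aut L C) s l" "accepting 3 (code_aut L C) s' l'"
    and y: "comp_word l 1 = comp_word l' 1" and w: "comp_word l 2 = comp_word l' 2"
  have inf: "infinite (comp_pos l j)" "infinite (comp_pos l' j)" if "j < 3" for j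
    using acc that by (auto simp: accepting_def)
  have run: "is_run (code_aut L C) s l" "is_run (code_aut L C) s' l'"
    using acc by (auto simp: accepting_def)
  show "comp_word l 0 = comp_word l' 0"
  proof
    fix m
    let ?B = "block L (\<lambda>j. (comp_word l 0 j, comp_word l 1 j))"
    let ?B' = "block L (\<lambda>j. (comp_word l' 0 j, comp_word l' 1 j))"
    let ?M = "Suc (m div L)"
    obtain t where t: "seg l 2 0 t = concat (map C (map ?B [0..<?M]))"
      using code_run_blocks[OF run(1) L, of "comp_word l 0" "comp_word l 1" ?M]
        comp_word_ncount[OF inf(1)[of 0]] comp_word_ncount[OF inf(1)[of 1]] by auto
    obtain t' where t': "seg l' 2 0 t' = concat (map C (map ?B' [0..<?M]))"
      using code_run_blocks[OF run(2) L, of "comp_word l' 0" "comp_word l' 1" ?M]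
        comp_word_ncount[OF inf(2)[of 0]] comp_word_ncount[OF inf(2)[of 1]] by auto
    \<comment> \<open>The two runs may have written outputs of different lengths so far;
      \<open>W\<close> is long enough to contain both.\<close>
    define n where "n = max (ncount l 2 t) (ncount l' 2 t')"
    define W where "W = map (comp_word l 2) [0..<n]"
    have pre: "prefix (map f [0..<a]) (map f [0..<n])" if "a \<le> n" for f :: "nat \<Rightarrow> 'a" and a
      using that map_mono_prefix[OF take_is_prefix[of a "[0..<n]"], of f] by simp
    have "prefix (concat (map C (map ?B [0..<?M]))) W"
      using seg_eq_map_comp_word[OF inf(1)[of 2], of t] pre[of "ncount l 2 t" "comp_word l 2"]
      unfolding t[symmetric] W_def n_def by simp
    moreover have "prefix (concat (map C (map ?B' [0..<?M]))) W"
      using seg_eq_map_comp_word[OF inf(2)[of 2], of t'] pre[of "ncount l' 2 t'" "comp_word l 2"]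
      unfolding t'[symmetric] W_def n_def w by simp
    moreover have "map snd (?B i) = map snd (?B' i)" for i
      by (simp add: block_def comp_def y del: One_nat_def)
    ultimately have "map ?B [0..<?M] = map ?B' [0..<?M]"
      by (intro prefix_code_concat_cancel[where C = C and L = L and w = W, OF pf]) auto
    then have "?B (m div L) = ?B' (m div L)" by simp
    then have "?B (m div L) ! (m mod L) = ?B' (m div L) ! (m mod L)" by simp
    then show "comp_word l 0 m = comp_word l' 0 m" using L by (simp add: nth_block)
  qed
qed

text \<open>The automaton driven by given tapes: the number \<open>m\<close> is the common position
  of both input heads, followed by the stored block and the pending output.\<close>

fun code_step :: "nat \<Rightarrow> (('a \<times> 'a) list \<Rightarrow> 'a list) \<Rightarrow> (nat \<Rightarrow> 'a \<times> 'a) \<Rightarrow>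
    nat \<times> ('a \<times> 'a) list \<times> 'a list \<Rightarrow> nat \<times> ('a \<times> 'a) list \<times> 'a list" where
  "code_step L C z (m, P, []) = (Suc m, next_conf L C P (z m))"
| "code_step L C z (m, P, c # O') = (m, P, O')"

fun code_label :: "(nat \<Rightarrow> 'a \<times> 'a) \<Rightarrow> nat \<times> ('a \<times> 'a) list \<times> 'a list \<Rightarrow> 'a option list" where
  "code_label z (m, P, []) = [Some (fst (z m)), Some (snd (z m)), None]"
| "code_label z (m, P, c # O') = [None, None, Some c]"

lemma code_run_exists:
  fixes C :: "('a::finite \<times> 'a) list \<Rightarrow> 'a list"
  assumes L: "L > 0"
  obtains s l where "is_run (code_aut L C) s l"
    "\<And>i a. l i ! 0 = Some a \<Longrightarrow> a = x (ncount l 0 i)"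
    "\<And>i a. l i ! 1 = Some a \<Longrightarrow> a = y (ncount l 1 i)"
proof -
  let ?M = "Max (insert 0 ((length \<circ> C) ` words L))"
  define z where "z j = (x j, y j)" for j
  define cfg where "cfg n = (code_step L C z ^^ n) (0, [], [])" for n
  define l where "l n = code_label z (cfg n)" for n
  define s where "s n = enc (snd (cfg n))" for n
  have cfg_Suc: "cfg (Suc n) = code_step L C z (cfg n)" for n by (simp add: cfg_def)
  \<comment> \<open>Output is pending only while the stored block is empty; without this part of the
    invariant \<open>code_trans\<close> would offer no writing move.\<close>
  have step: "(s n, l n, s (Suc n)) \<in> code_trans L C \<and> (\<forall>m P O'. cfg (Suc n) = (m, P, O') \<longrightarrow>
      length P < L \<and> length O' \<le> ?M \<and> (O' \<noteq> [] \<longrightarrow> P = []))"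
    if "cfg n = (m, P, O')" "length P < L" "length O' \<le> ?M" "O' \<noteq> [] \<longrightarrow> P = []" for n m P O'
  proof (cases O')
    case Nil
    obtain a b where ab: "z m = (a, b)" by fastforce
    have "(s n, l n, s (Suc n)) \<in> code_trans L C"
      using that(1,2) Nil ab by (auto simp: s_def l_def cfg_Suc code_trans_def)
    moreover have "length (C (P @ [z m])) \<le> ?M" if "Suc (length P) = L"
      using that by (intro length_code_le) simp
    ultimately show ?thesis
      using that(1,2) Nil L by (auto simp: cfg_Suc next_conf_def)
  next
    case (Cons c O'')
    then show ?thesis
      using that L by (auto simp: cfg_Suc s_def l_def code_trans_def)
  qed
  have inv: "case cfg n of (m, P, O') \<Rightarrow> length P < L \<and> length O' \<le> ?M \<and> (O' \<noteq> [] \<longrightarrow> P = []) \<and>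
      ncount l 0 n = m \<and> ncount l 1 n = m" for n
  proof (induction n)
    case 0
    show ?case using L by (simp add: cfg_def ncount_def)
  next
    case (Suc n)
    obtain m P O' where c: "cfg n = (m, P, O')" by (metis prod_cases3)
    obtain m1 P1 O1 where c1: "cfg (Suc n) = (m1, P1, O1)" by (metis prod_cases3)
    have IH: "length P < L" "length O' \<le> ?M" "O' \<noteq> [] \<longrightarrow> P = []" "ncount l 0 n = m" "ncount l 1 n = m"
      using Suc c by auto
    have "length P1 < L \<and> length O1 \<le> ?M \<and> (O1 \<noteq> [] \<longrightarrow> P1 = [])"
      using step[OF c IH(1-3)] c1 by blast
    moreover have "ncount l 0 (Suc n) = m1 \<and> ncount l 1 (Suc n) = m1"
      using IH(4,5) c c1 by (cases O') (auto simp: ncount_Suc cfg_Suc l_def)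
    ultimately show ?case using c1 by simp
  qed
  show thesis
  proof (rule that[of s l])
    have "(s n, l n, s (Suc n)) \<in> code_trans L C" for n
      using inv[of n] step[of n] by (cases "cfg n") auto
    moreover have "s 0 = enc ([] :: ('a \<times> 'a) list, [])" by (simp add: s_def cfg_def)
    ultimately show "is_run (code_aut L C) s l" by (simp add: is_run_def code_aut_def)
  next
    fix i a
    obtain m P O' where c: "cfg i = (m, P, O')" by (metis prod_cases3)
    show "l i ! 0 = Some a \<Longrightarrow> a = x (ncount l 0 i)" "l i ! 1 = Some a \<Longrightarrow> a = y (ncount l 1 i)"
      using inv[of i] c by (cases O'; simp add: l_def z_def)+
  qed
qed

text \<open>The ratio in \<open>rho_C_run\<close> is a lower limit, so it is enough to look at the
  moments when a suitable number \<open>M\<close> of blocks has been read and written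
  completely.\<close>

lemma rho_cond_le:
  fixes C :: "('a::finite \<times> 'a) list \<Rightarrow> 'a list"
  assumes L: "L > 0"
    and ne: "\<And>P. length P = L \<Longrightarrow> C P \<noteq> []"
    and pf: "\<And>P P'. length P = L \<Longrightarrow> length P' = L \<Longrightarrow> map snd P = map snd P' \<Longrightarrow>
      prefix (C P) (C P') \<Longrightarrow> P = P'"
    and freq: "\<And>M0. \<exists>M\<ge>M0. M > 0 \<and>
      real (\<Sum>i<M. length (C (block L (\<lambda>j. (x j, y j)) i))) \<le> \<theta> * real (M * L)"
  shows "rho_cond x y \<le> ereal \<theta>"
proof -
  let ?B = "block L (\<lambda>j. (x j, y j))"
  obtain s l where run: "is_run (code_aut L C) s l"
    and lx: "\<And>i a. l i ! 0 = Some a \<Longrightarrow> a = x (ncount l 0 i)"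
    and ly: "\<And>i a. l i ! 1 = Some a \<Longrightarrow> a = y (ncount l 1 i)"
    using code_run_exists[OF L, of C x y] by blast
  have times: "\<exists>t. ncount l 0 t = M * L \<and> ncount l 1 t = M * L \<and>
      ncount l 2 t = (\<Sum>i<M. length (C (?B i)))" for M
  proof -
    obtain t where t: "ncount l 0 t = M * L" "ncount l 1 t = M * L"
      "seg l 2 0 t = concat (map C (map ?B [0..<M]))"
      using code_run_blocks[where x = x and y = y and M = M, OF run L lx ly] by blast
    have "ncount l 2 t = (\<Sum>i<M. length (C (?B i)))"
      unfolding ncount_eq_length_seg t(3)
      by (simp add: length_concat comp_def interv_sum_list_conv_sum_set_nat atLeast0LessThan)
    with t show ?thesis by blast
  qed
  \<comment> \<open>At least one letter per block, so the output tape is infinite.\<close>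
  have out_ge: "M \<le> (\<Sum>i<M. length (C (?B i)))" for M
  proof -
    have "(\<Sum>i<M. 1) \<le> (\<Sum>i<M. length (C (?B i)))"
      using ne by (intro sum_mono) (simp add: Suc_le_eq)
    then show ?thesis by simp
  qed
  have inf: "infinite (comp_pos l j)" if "j < 3" for j
    unfolding infinite_comp_pos_iff
  proof
    fix m
    obtain t where t: "ncount l 0 t = m * L" "ncount l 1 t = m * L"
      "ncount l 2 t = (\<Sum>i<m. length (C (?B i)))" using times by blast
    have "m \<le> m * L" using L by simp
    then have "m \<le> ncount l 0 t" "m \<le> ncount l 1 t" "m \<le> ncount l 2 t"
      using t out_ge[of m] by simp_all
    moreover have "j = 0 \<or> j = 1 \<or> j = 2" using that by auto
    ultimately show "\<exists>n. m \<le> ncount l j n" by blast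
  qed
  have "accepting 3 (code_aut L C) s l" using run inf by (simp add: accepting_def)
  moreover have "comp_word l 0 = x" by (rule comp_word_eqI[of l 0 x, OF lx inf]) simp_all
  moreover have "comp_word l 1 = y" by (rule comp_word_eqI[of l 1 y, OF ly inf]) simp_all
  moreover have "compressor (code_aut L C)" by (rule compressor_code_aut[OF L pf])
  ultimately have "rho_cond x y \<le> rho_C_run l"
    unfolding rho_cond_def by (intro Inf_lower) blast
  also have "rho_C_run l \<le> ereal \<theta>"
  proof (rule ccontr)
    assume "\<not> rho_C_run l \<le> ereal \<theta>"
    then have "eventually (\<lambda>n. ereal \<theta> < ereal (real (ncount l 2 n) / real (ncount l 0 n))) sequentially"
      unfolding rho_C_run_def by (intro less_LiminfD) simp
    then obtain N where N: "\<And>n. n \<ge> N \<Longrightarrow> \<theta> < real (ncount l 2 n) / real (ncount l 0 n)"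
      unfolding eventually_sequentially by auto
    obtain M where M: "M \<ge> N" "M > 0"
      "real (\<Sum>i<M. length (C (?B i))) \<le> \<theta> * real (M * L)" using freq by blast
    obtain t where t: "ncount l 0 t = M * L" "ncount l 2 t = (\<Sum>i<M. length (C (?B i)))"
      using times by blast
    \<comment> \<open>A transition reads at most one input letter, so reading \<open>M * L\<close>
      letters takes at least that many steps and the time is late enough.\<close>
    have "N \<le> M * L" using M(1) mult_le_mono[OF M(1), of 1 L] L by simp
    also have "M * L \<le> t"
      unfolding t(1)[symmetric] ncount_def using card_mono[of "{..<t}" "{i. i < t \<and> l i ! 0 \<noteq> None}"]
      by auto
    finally have "\<theta> < real (\<Sum>i<M. length (C (?B i))) / real (M * L)" using N[of t] t by simp
    moreover have "real (M * L) > 0" using M L by simp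
    ultimately show False using M(3) by (simp add: pos_less_divide_eq)
  qed
  finally show ?thesis .
qed

section \<open>Aligned pairs of blocks and the join\<close>

definition pair_count :: "nat \<Rightarrow> (nat \<Rightarrow> 'a) \<Rightarrow> (nat \<Rightarrow> 'a) \<Rightarrow> 'a list \<Rightarrow> 'a list \<Rightarrow> nat \<Rightarrow> nat" where
  "pair_count l x y u v m = card {i. i < m \<and> block l x i = u \<and> block l y i = v}"

lemma card_less_Suc:
  "card {i. i < Suc m \<and> P i} = card {i. i < m \<and> P i} + (if P m then 1 else 0)"
proof -
  have "{i. i < Suc m \<and> P i} = (if P m then insert m {i. i < m \<and> P i} else {i. i < m \<and> P i})"
    by (auto simp: less_Suc_eq)
  then show ?thesis by simp
qed

lemma sum_lessThan_add:
  fixes f :: "nat \<Rightarrow> real"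
  shows "(\<Sum>j<a + k. f j) = (\<Sum>j<a. f j) + (\<Sum>i<k. f (a + i))"
  by (induction k) auto

lemma sum_lessThan_mult:
  fixes f :: "nat \<Rightarrow> real"
  shows "(\<Sum>i<M. \<Sum>i'<k. f (i * k + i')) = (\<Sum>j<M * k. f j)"
proof (induction M)
  case (Suc M)
  then show ?case using sum_lessThan_add[of f "M * k" k] by (simp add: add.commute)
qed simp

lemma chunk_block:
  assumes "i' < k"
  shows "chunk l i' (block (k * l) z i) = block l z (i * k + i')"
proof (rule nth_equalityI)
  have le: "Suc i' * l \<le> k * l" using assms by (intro mult_le_mono1) simp
  then show len: "length (chunk l i' (block (k * l) z i)) = length (block l z (i * k + i'))"
    by (simp add: chunk_def)
  fix j assume "j < length (chunk l i' (block (k * l) z i))"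
  then have j: "j < l" by (simp add: len)
  with le have lt: "i' * l + j < k * l" by simp
  have "chunk l i' (block (k * l) z i) ! j = block (k * l) z i ! (i' * l + j)"
  proof -
    have "i' * l \<le> length (block (k * l) z i)" using assms by simp
    then show ?thesis using j by (simp add: chunk_def nth_drop del: length_block)
  qed
  also have "\<dots> = block l z (i * k + i') ! j"
    using j lt by (simp add: nth_block add_mult_distrib mult.assoc add.assoc)
  finally show "chunk l i' (block (k * l) z i) ! j = block l z (i * k + i') ! j" .
qed

text \<open>At \<open>c = 0\<close> the expression vanishes and has derivative
  \<open>e * N > 0\<close>, so a small \<open>c\<close> works. Up to a factor
  \<open>N ^ 2 * ln b\<close>, with \<open>b\<close> the alphabet size, it is the mean saving per
  block when the pair has frequency \<open>(1 + e) / N ^ 2\<close> and \<open>v\<close> has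
  frequency \<open>1 / N\<close>.\<close>

lemma tilt_gain_positive:
  fixes N e :: real
  assumes "N \<ge> 2" "e > 0"
  obtains c where "0 < c" "c < 1" "(1 + e) * ln (1 + (N - 1) * c) + (N - 1 - e) * ln (1 - c) > 0"
proof -
  let ?f = "\<lambda>c. (1 + e) * ln (1 + (N - 1) * c) + (N - 1 - e) * ln (1 - c)"
  have "DERIV ?f 0 :> (1 + e) * (N - 1) - (N - 1 - e)"
    by (auto intro!: derivative_eq_intros)
  moreover have "(1 + e) * (N - 1) - (N - 1 - e) > 0"
    using assms by (simp add: algebra_simps)
  ultimately obtain d where d: "d > 0" "\<And>h. h > 0 \<Longrightarrow> h < d \<Longrightarrow> ?f 0 < ?f (0 + h)"
    using DERIV_pos_inc_right[of ?f] by blast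
  let ?c = "min (d / 2) (1 / 2)"
  have "?f 0 < ?f (0 + ?c)" using d(1) by (intro d(2)) auto
  then show thesis using d(1) by (intro that[of ?c]) auto
qed

text \<open>If some pair of words occurred too often, one would compress \<open>x\<close> relative to \<open>y\<close> with a
  Shannon code for the uniform distribution tilted slightly towards that pair.\<close>

lemma pair_count_upper_bound:
  fixes x y :: "nat \<Rightarrow> 'a::finite"
  assumes norx: "normal x" and nory: "normal y" and eq: "rho_cond x y = rho x"
    and l: "l > 0" and u: "length u = l" and v: "length v = l" and eta: "\<eta> > 0"
  shows "eventually (\<lambda>m. real (pair_count l x y u v m) \<le>
    (1 / real (CARD('a) ^ l) ^ 2 + \<eta>) * real m) sequentially"
proof (cases "CARD('a) \<ge> 2")
  case False
  moreover have "CARD('a) > 0" by simp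
  ultimately have one: "CARD('a) = 1" by linarith
  have "real (pair_count l x y u v m) \<le> (1 / real (CARD('a) ^ l) ^ 2 + \<eta>) * real m" for m
  proof -
    have "pair_count l x y u v m \<le> card {..<m}"
      unfolding pair_count_def by (rule card_mono) auto
    then have "real (pair_count l x y u v m) \<le> 1 * real m" by simp
    also have "\<dots> \<le> (1 / real (CARD('a) ^ l) ^ 2 + \<eta>) * real m"
      using eta by (intro mult_right_mono) (simp_all add: one)
    finally show ?thesis .
  qed
  then show ?thesis by simp
next
  case b2: True
  define b where "b = real CARD('a)"
  define N where "N = b ^ l"
  have b: "b \<ge> 2" using b2 by (simp add: b_def)
  have Nb: "N \<ge> b" using power_increasing[of 1 l b] l b by (simp add: N_def)
  have N2: "N \<ge> 2" using Nb b by linarith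
  have Npow: "real (CARD('a) ^ l) = N" by (simp add: N_def b_def)
  show ?thesis
  proof (rule ccontr)
    assume "\<not> ?thesis"
    then have fr: "\<exists>m\<ge>m0. real (pair_count l x y u v m) > (1 / N ^ 2 + \<eta>) * real m" for m0
      unfolding eventually_sequentially Npow by (meson not_le)
    \<comment> \<open>Chosen so that \<open>1 / N ^ 2 + \<eta> = (1 + e) / N ^ 2\<close>.\<close>
    define e where "e = \<eta> * N ^ 2"
    have e: "e > 0" using eta N2 by (simp add: e_def)
    obtain c where c: "0 < c" "c < 1"
      "(1 + e) * ln (1 + (N - 1) * c) + (N - 1 - e) * ln (1 - c) > 0"
      using tilt_gain_positive[OF N2 e] .
    \<comment> \<open>\<open>\<alpha>\<close> is the number of letters saved when the pair
      \<open>(u, v)\<close> occurs, \<open>\<beta>\<close> the number lost when \<open>v\<close>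
      faces another word.\<close>
    define \<alpha> where "\<alpha> = log b (1 + (N - 1) * c)"
    define \<beta> where "\<beta> = - log b (1 - c)"
    have "(N - 1) * c > 0" using c N2 by simp
    then have "1 < 1 + (N - 1) * c" by linarith
    then have \<alpha>: "\<alpha> > 0" unfolding \<alpha>_def using b by (subst zero_less_log_cancel_iff) linarith+
    have \<beta>: "\<beta> > 0" using c b by (simp add: \<beta>_def log_less_zero_cancel_iff)
    define D where "D = (1 + e) * \<alpha> - (N - 1 - e) * \<beta>"
    have "D = ((1 + e) * ln (1 + (N - 1) * c) + (N - 1 - e) * ln (1 - c)) / ln b"
      by (simp add: D_def \<alpha>_def \<beta>_def log_def add_divide_distrib)
    then have D: "D > 0" using c(3) b by simp
    \<comment> \<open>Given \<open>v\<close>, this is the mixture of the point mass at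
      \<open>u\<close>, with weight \<open>c\<close>, and the uniform distribution, with weight
      \<open>1 - c\<close>.\<close>
    define q where "q X Y = (if Y = v then if X = u then (1 + (N - 1) * c) / N else (1 - c) / N
        else 1 / N)" for X Y :: "'a list"
    have pos: "q X Y > 0" for X Y using c N2 by (simp add: q_def add_pos_nonneg)
    have card_w: "real (card (words l :: 'a list set)) = N" by (simp add: card_words N_def b_def)
    have q_sum: "(\<Sum>X\<in>words l. q X Y) \<le> 1" for Y
    proof (cases "Y = v")
      case False
      then show ?thesis using card_w N2 by (simp add: q_def)
    next
      case True
      have "(\<Sum>X\<in>words l. q X Y) = q u Y + (\<Sum>X\<in>words l - {u}. q X Y)"
        using u by (intro sum.remove) auto
      also have "(\<Sum>X\<in>words l - {u}. q X Y) = (\<Sum>X\<in>words l - {u}. (1 - c) / N)"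
        using True by (intro sum.cong) (auto simp: q_def)
      also have "\<dots> = (N - 1) * ((1 - c) / N)"
        using card_w u N2 by (simp add: of_nat_diff card_Diff_singleton)
      finally have "(\<Sum>X\<in>words l. q X Y) = (1 + (N - 1) * c) / N + (N - 1) * ((1 - c) / N)"
        using True by (simp add: q_def)
      also have "\<dots> = 1" using N2 by (simp add: field_simps)
      finally show ?thesis by simp
    qed
    \<comment> \<open>The ideal saving on block \<open>j\<close> compared with copying its
      \<open>l\<close> letters.\<close>
    define g where "g j = (if block l y j = v then if block l x j = u then \<alpha> else - \<beta> else 0)" for j
    have log_q: "log b (q (block l x j) (block l y j)) = g j - real l" for j
    proof -
      have "log b N = real l" using b by (simp add: N_def log_nat_power)
      moreover have "log b (t / N) = log b t - log b N" if "t > 0" for t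
        using that b N2 by (intro log_divide_pos) auto
      moreover have "1 + (N - 1) * c > 0" using c N2 by (simp add: add_pos_nonneg)
      ultimately show ?thesis using c by (simp add: q_def g_def \<alpha>_def \<beta>_def)
    qed
    have g_le: "g j \<le> \<alpha>" for j using \<alpha> \<beta> by (simp add: g_def)
    have sum_g: "(\<Sum>j<m. g j) = (\<alpha> + \<beta>) * real (pair_count l x y u v m) - \<beta> * real (block_count l y v m)"
      for m
    proof (induction m)
      case 0
      show ?case by (simp add: pair_count_def block_count_def)
    next
      case (Suc m)
      have "pair_count l x y u v (Suc m) = pair_count l x y u v m +
          (if block l x m = u \<and> block l y m = v then 1 else 0)"
        "block_count l y v (Suc m) = block_count l y v m + (if block l y m = v then 1 else 0)"
        unfolding pair_count_def block_count_def by (rule card_less_Suc)+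
      with Suc show ?case by (simp add: g_def algebra_simps)
    qed
    \<comment> \<open>The guaranteed mean saving is \<open>D / N ^ 2\<close>. Half of it is given up
      for the deviation of the frequency of \<open>v\<close>: a tolerance
      \<open>\<gamma> / \<beta>\<close> there costs \<open>\<gamma>\<close>.\<close>
    define \<gamma> where "\<gamma> = D / (2 * N ^ 2)"
    have \<gamma>: "\<gamma> > 0" using D N2 by (simp add: \<gamma>_def)
    have "1 / N < 1 / N + \<gamma> / \<beta>" using \<gamma> \<beta> by simp
    moreover have "(\<lambda>m. real (block_count l y v m) / real m) \<longlonglongrightarrow> 1 / N"
      using normal_block_count[OF nory l v] by (simp only: Npow)
    ultimately have "eventually (\<lambda>m. real (block_count l y v m) / real m < 1 / N + \<gamma> / \<beta>) sequentially"
      by (rule order_tendstoD[rotated])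
    then obtain m1 where m1: "\<And>m. m \<ge> m1 \<Longrightarrow> real (block_count l y v m) / real m < 1 / N + \<gamma> / \<beta>"
      unfolding eventually_sequentially by blast
    have gain: "\<exists>m\<ge>m0. (\<Sum>j<m. g j) \<ge> \<gamma> * real m" for m0
    proof -
      obtain m where m: "m \<ge> max m0 (max m1 1)"
        "real (pair_count l x y u v m) > (1 / N ^ 2 + \<eta>) * real m" using fr by blast
      then have m0: "real m > 0" by simp
      have "\<beta> * real (block_count l y v m) \<le> \<beta> * ((1 / N + \<gamma> / \<beta>) * real m)"
        using m1[of m] m m0 \<beta> by (intro mult_left_mono) (auto simp: pos_divide_less_eq)
      moreover have "(\<alpha> + \<beta>) * ((1 / N ^ 2 + \<eta>) * real m) \<le> (\<alpha> + \<beta>) * real (pair_count l x y u v m)"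
        using m \<alpha> \<beta> by (intro mult_left_mono) auto
      ultimately have "(\<Sum>j<m. g j) \<ge>
          (\<alpha> + \<beta>) * ((1 / N ^ 2 + \<eta>) * real m) - \<beta> * ((1 / N + \<gamma> / \<beta>) * real m)"
        unfolding sum_g by linarith
      also have "(\<alpha> + \<beta>) * ((1 / N ^ 2 + \<eta>) * real m) - \<beta> * ((1 / N + \<gamma> / \<beta>) * real m) =
          ((\<alpha> + \<beta>) * (1 / N ^ 2 + \<eta>) - \<beta> * (1 / N + \<gamma> / \<beta>)) * real m"
        by (simp add: algebra_simps)
      also have "(\<alpha> + \<beta>) * (1 / N ^ 2 + \<eta>) - \<beta> * (1 / N + \<gamma> / \<beta>) = D / N ^ 2 - \<gamma>"
        using N2 \<beta> by (simp add: D_def e_def field_simps power2_eq_square)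
      also have "D / N ^ 2 - \<gamma> = \<gamma>" by (simp add: \<gamma>_def)
      finally show ?thesis using m(1) by (intro exI[of _ m]) auto
    qed
    \<comment> \<open>One letter of rounding per group of \<open>k\<close> blocks is then at most a
      quarter of the saving \<open>\<gamma> * k\<close>. The incomplete last group will cost another
      quarter, hence the 2 in the definition of \<open>\<theta>\<close>.\<close>
    obtain k where k: "real k \<ge> 4 / \<gamma>" using real_arch_simple by blast
    then have k4: "real k * \<gamma> \<ge> 4" using \<gamma> by (simp add: pos_divide_le_eq)
    then have k0: "k > 0" by (cases k) auto
    define L where "L = k * l"
    have L: "L > 0" using k0 l by (simp add: L_def)
    define z where "z = (\<lambda>j. (x j, y j))"
    obtain C :: "('a \<times> 'a) list \<Rightarrow> 'a list" where C1: "\<And>P. length P = L \<Longrightarrow> C P \<noteq> []"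
      and C2: "\<And>P. length P = L \<Longrightarrow> real (length (C P)) \<le>
        1 - (\<Sum>i<k. log b (q (map fst (chunk l i P)) (map snd (chunk l i P))))"
      and C3: "\<And>P P'. length P = L \<Longrightarrow> length P' = L \<Longrightarrow> map snd P = map snd P' \<Longrightarrow>
        prefix (C P) (C P') \<Longrightarrow> P = P'"
      by (rule conditional_prefix_code[where q = q and l = l and k = k, OF b2 pos q_sum,
            folded L_def b_def]) blast
    have len: "real (length (C (block L z i))) \<le> 1 + real k * real l - (\<Sum>i'<k. g (i * k + i'))" for i
    proof -
      have "(\<Sum>i'<k. log b (q (map fst (chunk l i' (block L z i))) (map snd (chunk l i' (block L z i)))))
          = (\<Sum>i'<k. g (i * k + i') - real l)"
      proof (rule sum.cong)
        fix i' assume "i' \<in> {..<k}"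
        then have "chunk l i' (block L z i) = block l z (i * k + i')"
          unfolding L_def by (intro chunk_block) simp
        moreover have "map fst (block l z j) = block l x j" "map snd (block l z j) = block l y j" for j
          by (simp_all add: block_def z_def comp_def)
        ultimately show "log b (q (map fst (chunk l i' (block L z i))) (map snd (chunk l i' (block L z i))))
          = g (i * k + i') - real l" by (simp add: log_q)
      qed simp
      then show ?thesis using C2[of "block L z i"] by (simp add: sum_subtractf)
    qed
    define \<theta> where "\<theta> = 1 - \<gamma> / (2 * real l)"
    have "rho_cond x y \<le> ereal \<theta>"
    proof (rule rho_cond_le[OF L C1 C3])
      fix M0
      \<comment> \<open>With this many groups, the correction \<open>k * \<alpha>\<close> for the
        incomplete group is at most a quarter of the total saving.\<close>
      obtain M1 where M1: "real M1 \<ge> 4 * \<alpha> / \<gamma>" using real_arch_simple by blast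
      obtain m where m: "m \<ge> Suc (max M0 M1) * k" "(\<Sum>j<m. g j) \<ge> \<gamma> * real m" using gain by blast
      define M where "M = m div k"
      have M: "M \<ge> Suc (max M0 M1)"
        using m(1) k0 by (simp only: M_def less_eq_div_iff_mult_less_eq)
      have "m = M * k + m mod k" by (simp add: M_def)
      then have "(\<Sum>j<m. g j) = (\<Sum>j<M * k. g j) + (\<Sum>i<m mod k. g (M * k + i))"
        using sum_lessThan_add[of g "M * k" "m mod k"] by simp
      \<comment> \<open>The favourable moment \<open>m\<close> need not be a multiple of
        \<open>k\<close>; discarding the last incomplete group gives up at most
        \<open>\<alpha>\<close> per block.\<close>
      also have "(\<Sum>i<m mod k. g (M * k + i)) \<le> (\<Sum>i<m mod k. \<alpha>)" by (rule sum_mono) (rule g_le)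
      also have "\<dots> = real (m mod k) * \<alpha>" by simp
      also have "\<dots> \<le> real k * \<alpha>" using k0 \<alpha> by (intro mult_right_mono) (auto simp: less_imp_le)
      finally have S1: "(\<Sum>j<M * k. g j) \<ge> \<gamma> * real m - real k * \<alpha>" using m(2) by linarith
      have "\<gamma> * real (M * k) \<le> \<gamma> * real m"
        using \<gamma> by (intro mult_left_mono) (auto simp: M_def simp del: of_nat_mult)
      with S1 have S: "(\<Sum>j<M * k. g j) \<ge> \<gamma> * (real M * real k) - real k * \<alpha>" by simp
      have "real (\<Sum>i<M. length (C (block L z i))) \<le>
          (\<Sum>i<M. 1 + real k * real l - (\<Sum>i'<k. g (i * k + i')))"
        unfolding of_nat_sum by (rule sum_mono) (rule len)
      also have "\<dots> = real M * (1 + real k * real l) - (\<Sum>j<M * k. g j)"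
        by (simp only: sum_subtractf sum_lessThan_mult) simp
      also have "\<dots> \<le> real M + real M * real k * real l - \<gamma> * (real M * real k) + real k * \<alpha>"
        using S by (simp add: algebra_simps)
      also have "\<dots> \<le> real M * real k * real l - \<gamma> * (real M * real k) / 2"
      proof -
        have "real M * 4 \<le> real M * (real k * \<gamma>)" using k4 by (intro mult_left_mono) auto
        moreover have "4 * \<alpha> \<le> real M * \<gamma>"
        proof -
          have "4 * \<alpha> \<le> real M1 * \<gamma>" using M1 \<gamma> by (simp add: pos_divide_le_eq)
          also have "\<dots> \<le> real M * \<gamma>" using M \<gamma> by (intro mult_right_mono) auto
          finally show ?thesis .
        qed
        then have "real k * (4 * \<alpha>) \<le> real k * (real M * \<gamma>)" by (intro mult_left_mono) auto
        ultimately show ?thesis by (simp add: algebra_simps)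
      qed
      also have "\<dots> = \<theta> * real (M * L)" using l by (simp add: \<theta>_def L_def field_simps)
      finally have "real (\<Sum>i<M. length (C (block L (\<lambda>j. (x j, y j)) i))) \<le> \<theta> * real (M * L)"
        by (simp only: z_def)
      then show "\<exists>M\<ge>M0. M > 0 \<and>
          real (\<Sum>i<M. length (C (block L (\<lambda>j. (x j, y j)) i))) \<le> \<theta> * real (M * L)"
        using M by (intro exI[of _ M]) auto
    qed
    moreover have "1 \<le> rho x" by (rule normal_imp_rho_ge_1[OF norx b2])
    ultimately have "1 \<le> ereal \<theta>" unfolding eq by (rule order_trans[rotated])
    moreover have "\<theta> < 1" using \<gamma> l by (simp add: \<theta>_def)
    ultimately show False by (simp add: one_ereal_def)
  qed
qed

text \<open>A block of length \<open>2 * l\<close> of the join starts at an even position, so its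
  letters at even offsets come from \<open>x\<close> and the others from \<open>y\<close>, both from
  the same block index.\<close>

lemma block_join_imp:
  assumes "block (2 * l) (join x y) i = w"
  shows "block l x i = map (\<lambda>j. w ! (2 * j)) [0..<l]"
    and "block l y i = map (\<lambda>j. w ! (2 * j + 1)) [0..<l]"
proof -
  have w: "w ! j = join x y (i * (2 * l) + j)" if "j < 2 * l" for j
    using assms nth_block[OF that, of "join x y" i] by simp
  have div: "(i * (2 * l) + 2 * j) div 2 = i * l + j"
    "(i * (2 * l) + (2 * j + 1)) div 2 = i * l + j" for j
    by (simp_all add: algebra_simps)
  show "block l x i = map (\<lambda>j. w ! (2 * j)) [0..<l]"
    by (rule nth_equalityI) (simp_all add: nth_block w join_def div(1) del: add_mult_distrib2)
  show "block l y i = map (\<lambda>j. w ! (2 * j + 1)) [0..<l]"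
    by (rule nth_equalityI) (simp_all add: nth_block w join_def div(2)[simplified])
qed

lemma block_double:
  "block (2 * l) z i = block l z (2 * i) @ block l z (Suc (2 * i))"
proof -
  have "[i * (2 * l)..<Suc i * (2 * l)] = [2 * i * l..<Suc (2 * i) * l] @ [Suc (2 * i) * l..<Suc (Suc (2 * i)) * l]"
    using upt_add_eq_append[of "2 * i * l" "Suc (2 * i) * l" l] by (simp add: algebra_simps)
  then show ?thesis by (simp add: block_def)
qed

text \<open>An occurrence of \<open>u\<close> is the left or the right half of a block of double
  length, and each side allows \<open>CARD('a) ^ l\<close> completions.\<close>

lemma block_count_le_double:
  fixes z :: "nat \<Rightarrow> 'a::finite"
  assumes u: "length u = l"
    and up: "\<And>w :: 'a list. length w = 2 * l \<Longrightarrow> real (block_count (2 * l) z w (n div 2)) \<le> K"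
  shows "real (block_count l z u n) \<le> 2 * real (CARD('a) ^ l) * K + 1"
proof -
  define A1 A2 where "A1 = (\<lambda>w. u @ w) ` (words l :: 'a list set)" and "A2 = (\<lambda>w. w @ u) ` (words l :: 'a list set)"
  let ?S = "\<lambda>A. {i. i < n div 2 \<and> block (2 * l) z i \<in> A}"
  have K: "K \<ge> 0" using up[of "u @ u"] u by (simp add: order_trans[OF of_nat_0_le_iff])
  have bnd: "real (card (?S A)) \<le> real (CARD('a) ^ l) * K"
    if "A = A1 \<or> A = A2" for A
  proof -
    have fin: "finite A" and card: "card A \<le> CARD('a) ^ l"
      using that card_image_le[OF finite_words[of l, where 'a = 'a]]
      by (auto simp: A1_def A2_def card_words[symmetric])
    have "real (card (?S A)) = (\<Sum>w\<in>A. real (block_count (2 * l) z w (n div 2)))"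
      using sum_block_count[OF fin, of "2 * l" z "n div 2"] by (simp flip: of_nat_sum)
    also have "\<dots> \<le> (\<Sum>w\<in>A. K)"
      using that u by (intro sum_mono up) (auto simp: A1_def A2_def)
    also have "\<dots> = real (card A) * K" by simp
    also have "\<dots> \<le> real (CARD('a) ^ l) * K"
      using card K by (intro mult_right_mono) (simp_all only: of_nat_le_iff)
    finally show ?thesis .
  qed
  \<comment> \<open>The extra point \<open>n - 1\<close> covers odd \<open>n\<close>, when the last
    block is half of an incomplete double block.\<close>
  have sub: "{i. i < n \<and> block l z i = u} \<subseteq>
      (\<lambda>i. 2 * i) ` ?S A1 \<union> (\<lambda>i. Suc (2 * i)) ` ?S A2 \<union> {n - 1}"
  proof
    fix i assume i: "i \<in> {i. i < n \<and> block l z i = u}"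
    show "i \<in> (\<lambda>i. 2 * i) ` ?S A1 \<union> (\<lambda>i. Suc (2 * i)) ` ?S A2 \<union> {n - 1}"
    proof (cases "i div 2 < n div 2")
      case False
      then have "i = n - 1" using i by auto
      then show ?thesis by simp
    next
      case True
      show ?thesis
      proof (cases "even i")
        case True
        then obtain j where j: "i = 2 * j" by (elim evenE)
        then have "block (2 * l) z j \<in> A1" using i by (auto simp: block_double A1_def)
        then have "j \<in> ?S A1" using \<open>i div 2 < n div 2\<close> j by simp
        then show ?thesis using j by blast
      next
        case False
        then obtain j where j: "i = Suc (2 * j)" by (auto elim: oddE)
        then have "block (2 * l) z j \<in> A2" using i by (auto simp: block_double A2_def)
        then have "j \<in> ?S A2" using \<open>i div 2 < n div 2\<close> j by simp
        then show ?thesis using j by blast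
      qed
    qed
  qed
  have "block_count l z u n \<le> card ((\<lambda>i. 2 * i) ` ?S A1 \<union> (\<lambda>i. Suc (2 * i)) ` ?S A2 \<union> {n - 1})"
    unfolding block_count_def using sub by (intro card_mono) auto
  also have "\<dots> \<le> card ((\<lambda>i. 2 * i) ` ?S A1) + card ((\<lambda>i. Suc (2 * i)) ` ?S A2) + card {n - 1}"
    by (meson add_le_mono1 card_Un_le le_trans)
  also have "\<dots> \<le> card (?S A1) + card (?S A2) + 1"
    by (intro add_mono card_image_le) auto
  finally have "real (block_count l z u n) \<le> real (card (?S A1)) + real (card (?S A2)) + 1"
    by linarith
  then show ?thesis using bnd[of A1] bnd[of A2] by simp
qed

text \<open>Upper bounds suffice because the frequencies of all words of length \<open>l\<close> add up to 1.\<close>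

lemma normal_if_upper_bounds:
  fixes z :: "nat \<Rightarrow> 'a::finite"
  assumes up: "\<And>l u \<eta>. l > 0 \<Longrightarrow> length u = l \<Longrightarrow> \<eta> > 0 \<Longrightarrow>
    eventually (\<lambda>n. real (block_count l z u n) \<le> (1 / real (CARD('a) ^ l) + \<eta>) * real n) sequentially"
  shows "normal z"
  unfolding normal_def
proof (intro allI impI)
  fix l :: nat and u :: "'a list"
  assume "1 \<le> l" and u: "length u = l"
  then have l: "l > 0" by simp
  define N where "N = real (CARD('a) ^ l)"
  have N: "N \<ge> 1" unfolding N_def by simp
  let ?f = "\<lambda>n. real (block_count l z u n) / real n"
  have lim: "?f \<longlonglongrightarrow> 1 / N"
  proof (rule LIMSEQ_I)
    fix r :: real assume r: "r > 0"
    \<comment> \<open>The other \<open>N - 1\<close> words may exceed their share by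
      \<open>\<eta>\<close> each, so \<open>u\<close> falls short by at most
      \<open>(N - 1) * \<eta> < r\<close>.\<close>
    define \<eta> where "\<eta> = r / (2 * N)"
    have \<eta>: "\<eta> > 0" using r N by (simp add: \<eta>_def)
    have "eventually (\<lambda>n. \<forall>w\<in>words l. real (block_count l z w n) \<le> (1 / N + \<eta>) * real n) sequentially"
      unfolding N_def by (intro eventually_ball_finite ballI up l \<eta>) auto
    then obtain n0 where n0: "\<And>n w. n \<ge> n0 \<Longrightarrow> length w = l \<Longrightarrow>
        real (block_count l z w n) \<le> (1 / N + \<eta>) * real n"
      unfolding eventually_sequentially words_iff Ball_def by blast
    have "norm (?f n - 1 / N) < r" if n: "n \<ge> max n0 1" for n
    proof -
      have pos: "real n > 0" using n by simp
      have hi: "real (block_count l z u n) \<le> (1 / N + \<eta>) * real n" using n0 n u by simp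
      have "real n = (\<Sum>w\<in>words l. real (block_count l z w n))"
        using sum_block_count[OF finite_words[of l, where 'a = 'a], of l z n]
        by (simp flip: of_nat_sum)
      also have "\<dots> = real (block_count l z u n) + (\<Sum>w\<in>words l - {u}. real (block_count l z w n))"
        using u by (intro sum.remove) auto
      also have "(\<Sum>w\<in>words l - {u}. real (block_count l z w n)) \<le>
          (\<Sum>w\<in>words l - {u}. (1 / N + \<eta>) * real n)"
        using n n0 by (intro sum_mono) auto
      also have "\<dots> = (N - 1) * ((1 / N + \<eta>) * real n)"
        using u by (simp add: card_Diff_singleton card_words N_def of_nat_diff)
      finally have "(1 - (N - 1) * (1 / N + \<eta>)) * real n \<le> real (block_count l z u n)"
        by (simp add: algebra_simps)
      moreover have "1 - (N - 1) * (1 / N + \<eta>) = 1 / N + \<eta> - N * \<eta>"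
        using N by (simp add: field_simps)
      ultimately have "1 / N + \<eta> - N * \<eta> \<le> ?f n" using pos by (simp add: pos_le_divide_eq)
      moreover have "?f n \<le> 1 / N + \<eta>" using hi pos by (simp add: pos_divide_le_eq)
      moreover have "N * \<eta> < r" using r N by (simp add: \<eta>_def)
      moreover have "\<eta> \<le> N * \<eta>" using N \<eta> by simp
      ultimately show ?thesis unfolding real_norm_def abs_less_iff using \<eta> by linarith
    qed
    then show "\<exists>n0. \<forall>n\<ge>n0. norm (?f n - 1 / N) < r" by blast
  qed
  have div: "filterlim (\<lambda>n. n div l) sequentially sequentially"
    unfolding filterlim_at_top
  proof
    fix Z
    show "eventually (\<lambda>n. Z \<le> n div l) sequentially"
      using eventually_ge_at_top[of "Z * l"]
      by eventually_elim (use l in \<open>simp add: less_eq_div_iff_mult_less_eq\<close>)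
  qed
  \<comment> \<open>\<open>normal\<close> divides by the real number \<open>n / l\<close>, whereas
    blocks are counted by \<open>n div l\<close>; the quotient of the two tends to 1.\<close>
  have ratio: "(\<lambda>n. real (n div l * l) / real n) \<longlonglongrightarrow> 1"
  proof (rule tendsto_sandwich[of "\<lambda>n. 1 - real l / real n" _ _ "\<lambda>n. 1"])
    show "eventually (\<lambda>n. 1 - real l / real n \<le> real (n div l * l) / real n) sequentially"
      using eventually_gt_at_top[of 0]
    proof eventually_elim
      case (elim n)
      have "n \<le> n div l * l + l" using l by (metis add_le_cancel_left div_mult_mod_eq less_imp_le mod_less_divisor)
      then have "real n \<le> real (n div l * l) + real l" by linarith
      then show ?case using elim by (simp add: pos_le_divide_eq left_diff_distrib)
    qed
    show "eventually (\<lambda>n. real (n div l * l) / real n \<le> 1) sequentially"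
      using eventually_gt_at_top[of 0]
      by eventually_elim (simp add: divide_le_eq_1 del: of_nat_mult)
    show "(\<lambda>n. 1 - real l / real n) \<longlonglongrightarrow> 1"
      using tendsto_diff[OF tendsto_const lim_const_over_n[of "real l"], of 1] by simp
  qed auto
  have "(\<lambda>n. ?f (n div l) * (real (n div l * l) / real n)) \<longlonglongrightarrow> 1 / N * 1"
    by (intro tendsto_mult ratio filterlim_compose[OF lim div])
  moreover have "real (aligned_count z n u) / (real n / real l) =
      ?f (n div l) * (real (n div l * l) / real n)" for n
  proof (cases "n div l = 0")
    case True
    then show ?thesis by (simp add: aligned_count_eq_block_count[OF l u] block_count_def)
  qed (use l in \<open>simp add: aligned_count_eq_block_count[OF l u] field_simps\<close>)
  ultimately have "(\<lambda>n. real (aligned_count z n u) / (real n / real l)) \<longlonglongrightarrow> 1 / N * 1"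
    by (simp only:)
  then show "(\<lambda>n. real (aligned_count z n u) / (real n / real l))
      \<longlonglongrightarrow> 1 / real (card (UNIV :: 'a set)) ^ l"
    by (simp only: N_def of_nat_power mult_1_right)
qed

theorem theorem6:
  fixes x y :: "nat \<Rightarrow> 'a::finite"
  assumes "normal x" and "normal y" and "fs_independent x y"
  shows "normal (join x y)"
proof (rule normal_if_upper_bounds)
  fix l :: nat and u :: "'a list" and \<eta> :: real
  assume l: "l > 0" and u: "length u = l" and \<eta>: "\<eta> > 0"
  let ?z = "join x y"
  define N where "N = real (CARD('a) ^ l)"
  have N: "N \<ge> 1" unfolding N_def by simp
  \<comment> \<open>Passing from length \<open>2 * l\<close> to \<open>l\<close> multiplies the
    frequency bound by \<open>N\<close>, so \<open>e\<close> contributes \<open>\<eta> / 2\<close>;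
    the other half absorbs the additive 1 of \<open>block_count_le_double\<close>.\<close>
  define e where "e = \<eta> / (2 * N)"
  have e: "e > 0" using \<eta> N by (simp add: e_def)
  let ?K = "\<lambda>m. (1 / N ^ 2 + e) * real m"
  have pair: "eventually (\<lambda>m. real (block_count (2 * l) ?z w m) \<le> ?K m) sequentially" for w
  proof -
    define w1 w2 where "w1 = map (\<lambda>j. w ! (2 * j)) [0..<l]" and "w2 = map (\<lambda>j. w ! (2 * j + 1)) [0..<l]"
    have "eventually (\<lambda>m. real (pair_count l x y w1 w2 m) \<le> ?K m) sequentially"
      using assms l e unfolding N_def fs_independent_def
      by (intro pair_count_upper_bound) (auto simp: w1_def w2_def)
    then show ?thesis
    proof eventually_elim
      case (elim m)
      have "block_count (2 * l) ?z w m \<le> pair_count l x y w1 w2 m"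
        unfolding block_count_def pair_count_def w1_def w2_def
      proof (rule card_mono)
        show "{i. i < m \<and> block (2 * l) ?z i = w} \<subseteq> {i. i < m \<and>
            block l x i = map (\<lambda>j. w ! (2 * j)) [0..<l] \<and> block l y i = map (\<lambda>j. w ! (2 * j + 1)) [0..<l]}"
          using block_join_imp[of l x y _ w] by blast
      qed simp
      then show ?case using elim by linarith
    qed
  qed
  then have "eventually (\<lambda>m. \<forall>w\<in>words (2 * l). real (block_count (2 * l) ?z w m) \<le> ?K m) sequentially"
    by (intro eventually_ball_finite) auto
  then obtain m0 where m0: "\<And>m w. m \<ge> m0 \<Longrightarrow> length w = 2 * l \<Longrightarrow>
      real (block_count (2 * l) ?z w m) \<le> ?K m"
    unfolding eventually_sequentially words_iff Ball_def by blast
  \<comment> \<open>From \<open>n1\<close> on, the additive 1 is at most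
    \<open>\<eta> / 2 * n\<close>.\<close>
  obtain n1 where n1: "real n1 \<ge> 2 / \<eta>" using real_arch_simple by blast
  show "eventually (\<lambda>n. real (block_count l ?z u n) \<le> (1 / real (CARD('a) ^ l) + \<eta>) * real n) sequentially"
    using eventually_ge_at_top[of "max (2 * m0) n1"]
  proof eventually_elim
    case (elim n)
    have "real (block_count l ?z u n) \<le> 2 * N * ?K (n div 2) + 1"
      unfolding N_def
      by (rule block_count_le_double[OF u]) (use elim m0 in \<open>auto simp: N_def\<close>)
    also have "\<dots> \<le> N * ?K n + 1"
    proof -
      have "2 * real (n div 2) \<le> real n" by linarith
      then have "(N * (1 / N ^ 2 + e)) * (2 * real (n div 2)) \<le> (N * (1 / N ^ 2 + e)) * real n"
        using N e by (intro mult_left_mono) auto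
      moreover have "2 * N * ?K (n div 2) = (N * (1 / N ^ 2 + e)) * (2 * real (n div 2))"
        "N * ?K n = (N * (1 / N ^ 2 + e)) * real n" by (simp_all only: mult_ac)
      ultimately show ?thesis by (simp only: add_le_cancel_right)
    qed
    also have "\<dots> = (1 / N + \<eta> / 2) * real n + 1"
      using N by (simp add: e_def field_simps power2_eq_square)
    finally have "real (block_count l ?z u n) \<le> (1 / N + \<eta> / 2) * real n + 1" .
    moreover have "1 \<le> \<eta> / 2 * real n"
    proof -
      have "2 / \<eta> \<le> real n" using n1 elim by linarith
      then show ?thesis using \<eta> by (simp add: field_simps)
    qed
    ultimately have "real (block_count l ?z u n) \<le> (1 / N + \<eta>) * real n"
      by (simp add: distrib_right)
    then show ?case by (simp only: N_def)
  qed
qed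

end
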